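(* Let $n,p\ge 1$ be integers, let $m_1,\dots,m_p$ be non-negative integers with $|m|=m_1+\dots+m_p$, and let $a_1,\dots,a_n$, $b$, $d$, $c_1,\dots,c_p$, $z_1,\dots,z_n$ be complex parameters such that $|q^{1-|m|}/bd|<1$ and no denominators in the identity below vanish. Then $$\sum_{y_1,\dots,y_n=-\infty}^\infty\Bigg(\frac{W(zq^y)}{W(z)} \prod_{\substack{1\leq k\leq n\\1\leq j\leq p}} \frac{(q^{m_j}c_jz_k,\,qz_k/c_j)_{y_k}}{(c_jz_k,\,q^{1-m_j}z_k/c_j)_{y_k}} \prod_{j,k=1}^n \frac{(a_jz_k,\,z_k/a_j)_{y_k}}{(qa_jz_k,\,qz_k/a_j)_{y_k}} \prod_{k=1}^n \frac{(bz_k,\,dz_k)_{y_k}}{(qz_k/b,\,qz_k/d)_{y_k}} \left(\frac{q^{1-|m|}}{bd}\right)^{|y|}\Bigg)$$ $$= \prod_{j,k=1}^n\frac{(qz_k/z_j,\,qa_k/a_j)_\infty}{(qz_k/a_j,\,qz_ka_j,\, q/a_jz_k,\,qa_j/z_k)_\infty} \prod_{k=1}^n\frac{(qa_k/b,\,q/a_kb,\,qa_k/d,\,q/a_kd)_\infty} {(qz_k/b,\,q/z_kb,\,qz_k/d,\,q/z_kd)_\infty}$$ $$\times\prod_{1\leq j\leq k\leq n} (qz_jz_k,\,q/z_jz_k)_\infty\prod_{1\leq j< k\leq n} (qa_ja_k,\,q/a_ja_k)_\infty \prod_{\substack{1\leq k\leq n\\1\leq j\leq p}}\frac{(c_ja_k,\,c_j/a_k)_{m_j}}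 {(c_jz_k,\,c_j/z_k)_{m_j}}.$$
   Context: Throughout, $q$ is a fixed complex number with $0<|q|<1$. For an integer $k$, $(a)_k=(1-a)(1-aq)\cdots(1-aq^{k-1})$ if $k\ge 0$ (so $(a)_0=1$), and $(a)_k=\dfrac{1}{(1-aq^{-1})(1-aq^{-2})\cdots(1-aq^{k})}$ if $k<0$; $(a)_\infty=\prod_{j=0}^\infty(1-aq^j)$. Also $(a_1,\dots,a_r)_k=(a_1)_k\cdots(a_r)_k$, and likewise with $k=\infty$. An expression such as $q/z_jz_k$ means $q/(z_jz_k)$. For a tuple $y$, $|y|$ denotes the sum of its coordinates, and $zq^y=(z_1q^{y_1},\dots,z_nq^{y_n})$. For an $n$-tuple $u=(u_1,\dots,u_n)$, $W(u)=\prod_{1\le j\le k\le n}(1-u_ju_k)\prod_{1\le j<k\le n}(u_j-u_k)$. Hence $$\frac{W(zq^y)}{W(z)}=\prod_{1\le j\le k\le n}\frac{1-z_jz_kq^{y_j+y_k}}{1-z_jz_k}\prod_{1\le j<k\le n}\frac{q^{y_j}z_j-q^{y_k}z_k}{z_j-z_k}.$$ The assumption that no denominators vanish includes that parameters by which one divides are non-zero and that the shifted factorials $(a)_k$ with $k<0$ which occur are well defined. The condition $|q^{1-|m|}/bd|<1$ ensures that the multiple series over $\mathbb Z^n$ is absolutely convergent. *)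

theory Defs
  imports "HOL-Analysis.Analysis"
begin

text \<open>
  An integer-indexed $q$-shifted factorial $(a)_k$. For $k < 0$ the value is the reciprocal
  $1 / ((1 - a q^{-1}) \cdots (1 - a q^{k}))$, which makes sense only under
  \<open>qpoch_defined q a k\<close>; otherwise division by zero makes it $0$.
\<close>

definition qpoch :: "complex \<Rightarrow> complex \<Rightarrow> int \<Rightarrow> complex" where
  "qpoch q a k =
     (if k \<ge> 0 then (\<Prod>i<nat k. 1 - a * q ^ i)
      else 1 / (\<Prod>i=1..nat (- k). 1 - a * q powi (- int i)))"

definition qpoch_defined :: "complex \<Rightarrow> complex \<Rightarrow> int \<Rightarrow> bool" where
  "qpoch_defined q a k \<longleftrightarrow>
     (k < 0 \<longrightarrow> (\<forall>i\<in>{1..nat (- k)}. 1 - a * q powi (- int i) \<noteq> 0))"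

definition qpoch_inf :: "complex \<Rightarrow> complex \<Rightarrow> complex" where
  "qpoch_inf q a = (\<Prod>i. 1 - a * q ^ i)"

text \<open>
  The condensed notation $(a_1, \dots, a_r)_k = (a_1)_k \cdots (a_r)_k$, also for $k = \infty$.
\<close>

definition qpochs :: "complex \<Rightarrow> complex list \<Rightarrow> int \<Rightarrow> complex" where
  "qpochs q as k = (\<Prod>a\<leftarrow>as. qpoch q a k)"

definition qpochs_defined :: "complex \<Rightarrow> complex list \<Rightarrow> int \<Rightarrow> bool" where
  "qpochs_defined q as k \<longleftrightarrow> (\<forall>a\<in>set as. qpoch_defined q a k)"

definition qpochs_inf :: "complex \<Rightarrow> complex list \<Rightarrow> complex" where
  "qpochs_inf q as = (\<Prod>a\<leftarrow>as. qpoch_inf q a)"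

text \<open>
  Here and below, an $n$-tuple is a function on \<open>nat\<close> of which only the values at
  $1, \dots, n$ matter.
\<close>

definition W :: "nat \<Rightarrow> (nat \<Rightarrow> complex) \<Rightarrow> complex" where
  "W n u = (\<Prod>k=1..n. \<Prod>j=1..k. 1 - u j * u k) * (\<Prod>k=1..n. \<Prod>j=1..<k. u j - u k)"

definition qshift :: "complex \<Rightarrow> (nat \<Rightarrow> complex) \<Rightarrow> (nat \<Rightarrow> int) \<Rightarrow> nat \<Rightarrow> complex" where
  "qshift q z y = (\<lambda>k. z k * q powi y k)"

text \<open>
  The index set $\mathbf{Z}^n$; extensionality (a fixed value outside $\{1, \dots, n\}$) ensures
  that every integer tuple is counted exactly once.
\<close>

definition int_tuples :: "nat \<Rightarrow> (nat \<Rightarrow> int) set" where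
  "int_tuples n = (\<Pi>\<^sub>E k\<in>{1..n}. UNIV)"

end

theory Submission
  imports Defs "Jordan_Normal_Form.Determinant"
begin

text \<open>
  Put $s(x) = x + 1/x$ and $x_k = z_k q^{y_k}$. Up to monomials, the factors of $W(x)$ and of the
  $a$-product are differences of the numbers $s(x_k)$ and $s(a_j)$; they assemble to a Cauchy
  determinant $\det (1/(s(x_k) - s(a_j)))$, and the multiple sum becomes a determinant of simple sums
  $\sum_y \frac{1/x - x}{s(x) - s(a)} Q(x) z^{2y} q^{y^2}$ with $x = z q^y$, where $Q$ is a product of
  factors $(1 - ux)(1 - u/x)$, finitely many from the $c_j$ and infinitely many from $b$ and $d$.
  Every such factor is linear in $s(x)$, and the Gaussian weight annihilates $x^{-j} - x^j$, so each
  factor may be replaced by its value at $a$: the simple sum is $Q(a)$ times its value for $Q = 1$.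
  A choice of $Q$ that kills all terms but $y = 0$ gives that value as the reciprocal of a product of
  theta functions in $z$ and $a$. The resulting elliptic determinant is reduced to another
  Cauchy determinant, because the same simple sums yield, by partial fractions, functions $h$ and $R$
  that write this product of theta functions as $h(z) h(a) (R(z) - R(a))$. Coinciding values $s(a_j)$
  are reached by continuity.
\<close>

text \<open>Replacing a factor by its value at \<open>a\<close> works for finitely many factors
  only. The products attached to \<open>b\<close> and \<open>d\<close> are limits of truncations,
  which calls for a summable majorant uniform in the truncation, and this is where the convergence
  hypothesis enters. Under x -> q x with x small, each of the |m| finite factors costs 1/|q|, the
  Gaussian weight contributes q x^2 and the two infinite products about 1/(b d x^2), so the bound
  for the ratio of consecutive majorants tends to |q^(1-|m|)/(b d)|. Invariance under x -> 1/x gives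
  the same condition at the other end. The Vandermonde product in the s(a_j) occurs on both sides:
  in the Cauchy determinant, and inside the theta functions of the elliptic determinant. It is
  divided out while the s(a_j) are distinct; what remains has limits when some of them coincide. In
  the lemmas on simple and multiple sums, \<open>b\<close> and \<open>d\<close> stand for what are
  1/b and 1/d in the theorem.\<close>

locale qbase =
  fixes q :: complex
  assumes q_nz: "q \<noteq> 0" and q_lt: "norm q < 1"
begin

section \<open>Infinite q-products: recurrence, zeros, continuity\<close>

lemma summable_norm_q: "summable (\<lambda>i. norm (a * q ^ i))"
  using q_lt by (simp add: norm_mult norm_power summable_mult summable_geometric)

lemma convergent_prod_q: "convergent_prod (\<lambda>i. 1 - a * q ^ i)"
  using summable_norm_q[of "- a"]
  by (intro abs_convergent_prod_imp_convergent_prod summable_imp_abs_convergent_prod)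
     (simp add: norm_mult)

lemma qpoch_inf_limit: "(\<lambda>N. \<Prod>i<N. 1 - a * q ^ i) \<longlonglongrightarrow> qpoch_inf q a"
  using has_prod_imp_tendsto'[OF convergent_prod_has_prod[OF convergent_prod_q]]
  by (simp add: qpoch_inf_def)

lemma qpoch_inf_0 [simp]: "qpoch_inf q 0 = 1"
  by (simp add: qpoch_inf_def)

lemma qpoch_inf_rec: "qpoch_inf q a = (1 - a) * qpoch_inf q (q * a)"
proof (rule LIMSEQ_unique)
  show "(\<lambda>N. \<Prod>i<Suc N. 1 - a * q ^ i) \<longlonglongrightarrow> qpoch_inf q a"
    using LIMSEQ_Suc[OF qpoch_inf_limit] .
  have "(\<Prod>i<Suc N. 1 - a * q ^ i) = (1 - a) * (\<Prod>i<N. 1 - (q * a) * q ^ i)" for N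
    by (subst prod.lessThan_Suc_shift) (simp add: mult_ac)
  then show "(\<lambda>N. \<Prod>i<Suc N. 1 - a * q ^ i) \<longlonglongrightarrow> (1 - a) * qpoch_inf q (q * a)"
    using tendsto_mult[OF tendsto_const qpoch_inf_limit[of "q * a"]] by simp
qed

lemma qpoch_inf_eq_0_iff: "qpoch_inf q a = 0 \<longleftrightarrow> (\<exists>i. a * q ^ i = 1)"
proof
  assume "qpoch_inf q a = 0"
  then show "\<exists>i. a * q ^ i = 1"
    using prodinf_nonzero[OF convergent_prod_q[of a]] unfolding qpoch_inf_def by auto
next
  assume "\<exists>i. a * q ^ i = 1"
  then have "(\<lambda>i. 1 - a * q ^ i) has_prod 0"
    using convergent_prod_has_prod[OF convergent_prod_q[of a]] has_prod_eq_0_iff by force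
  then show "qpoch_inf q a = 0"
    using has_prod_unique unfolding qpoch_inf_def by metis
qed

lemma continuous_on_qpoch_inf: "continuous_on UNIV (qpoch_inf q)"
proof -
  have "isCont (qpoch_inf q) a" for a
  proof -
    \<comment> \<open>Uniform convergence is available on balls; this radius makes \<open>a\<close>
      an interior point.\<close>
    define R where "R = norm a + 1"
    have "uniformly_convergent_on (cball 0 R) (\<lambda>N x. \<Sum>n<N. norm ((1 - x * q ^ n) - 1))"
    proof (rule Weierstrass_m_test')
      show "norm (norm ((1 - x * q ^ n) - 1)) \<le> R * norm q ^ n" if "x \<in> cball 0 R" for n x
        using that by (auto simp: norm_mult norm_power intro!: mult_right_mono)
      show "summable (\<lambda>n. R * norm q ^ n)"
        using q_lt by (intro summable_mult summable_geometric) auto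
    qed
    then have "uniformly_convergent_on (cball 0 R) (\<lambda>N x. \<Prod>n<N. 1 - x * q ^ n)"
      by (intro uniformly_convergent_on_prod') (auto intro!: continuous_intros)
    then obtain g where g: "uniform_limit (cball 0 R) (\<lambda>N x. \<Prod>n<N. 1 - x * q ^ n) g sequentially"
      by (auto simp: uniformly_convergent_on_def)
    have "continuous_on (cball 0 R) g"
      by (rule uniform_limit_theorem[OF _ g]) (auto intro!: always_eventually continuous_intros)
    moreover have "g x = qpoch_inf q x" if "x \<in> cball 0 R" for x
      using tendsto_uniform_limitI[OF g that] qpoch_inf_limit LIMSEQ_unique by blast
    ultimately have "continuous_on (cball 0 R) (qpoch_inf q)"
      using continuous_on_cong[OF refl, of "cball 0 R" g "qpoch_inf q"] by blast
    then have "continuous_on (ball 0 R) (qpoch_inf q)"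
      by (rule continuous_on_subset) auto
    then show ?thesis
      by (rule continuous_on_interior) (auto simp: R_def)
  qed
  then show ?thesis by (simp add: continuous_on_eq_continuous_at)
qed

lemma tendsto_qpoch_inf [tendsto_intros]:
  "(f \<longlongrightarrow> l) F \<Longrightarrow> ((\<lambda>x. qpoch_inf q (f x)) \<longlongrightarrow> qpoch_inf q l) F"
  using continuous_on_qpoch_inf continuous_on_tendsto_compose[of UNIV "qpoch_inf q" f l F] by auto

section \<open>Symmetrised variables and theta functions\<close>

definition symp :: "complex \<Rightarrow> complex" where "symp x = x + 1 / x"

text \<open>For nonzero \<open>x\<close>, the diagonal factor 1 - x^2 of \<open>W\<close> divided by
  \<open>x\<close>. It changes sign under x -> 1/x, where \<open>symp\<close> is invariant.\<close>

definition asym :: "complex \<Rightarrow> complex" where "asym x = 1 / x - x"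

text \<open>Reciprocal of the multiplier that \<open>thdiff u\<close> acquires from \<open>z\<close>
  to \<open>z * q powi y\<close>, whatever \<open>u\<close> is; see
  \<open>thdiff_gauss\<close>.\<close>

definition gauss :: "complex \<Rightarrow> int \<Rightarrow> complex" where
  "gauss z y = z powi (2 * y) * q powi (y * y)"

text \<open>Invariant under x -> 1/x, being an infinite product of factors linear in
  \<open>symp x\<close>. The theorem uses it with \<open>u = 1 / b\<close> and
  \<open>u = 1 / d\<close>.\<close>

definition qpair :: "complex \<Rightarrow> complex \<Rightarrow> complex" where
  "qpair u x = qpoch_inf q (q * u * x) * qpoch_inf q (q * u / x)"

definition theta4 :: "complex \<Rightarrow> complex \<Rightarrow> complex" where
  "theta4 u x = qpair u x * qpair (1 / u) x"

text \<open>The difference supplies the index-0 factors that \<open>theta4\<close> lacks, so that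
  two complete Jacobi theta functions result (\<open>thdiff_theta\<close>).\<close>

definition thdiff :: "complex \<Rightarrow> complex \<Rightarrow> complex" where
  "thdiff u x = (symp u - symp x) * theta4 u x"

lemma theta4_commute: "theta4 u x = theta4 x u"
  by (simp add: theta4_def qpair_def mult_ac)

lemma thdiff_antisym: "thdiff u x = - thdiff x u"
  by (simp add: thdiff_def theta4_commute[of u] algebra_simps)

lemma symp_diff:
  assumes "a \<noteq> 0" "x \<noteq> 0"
  shows "(1 - a * x) * (1 - x / a) = x * (symp x - symp a)"
    and "(1 - a * x) * (a - x) = a * x * (symp x - symp a)"
  using assms by (auto simp: symp_def divide_simps) (auto simp: algebra_simps)

lemma linear_symp:
  assumes "x \<noteq> 0"
  shows "(1 - u * x) * (1 - u / x) = 1 + u ^ 2 - u * symp x"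
  using assms by (simp add: symp_def field_simps power2_eq_square)

text \<open>Only the downward induction divides by the ratio, so it may vanish at nonnegative
  indices, as happens when a numerator terminates.\<close>

lemma int_recurrence_unique:
  fixes f g :: "int \<Rightarrow> complex"
  assumes "f 0 = g 0"
    and "\<And>y. f (y + 1) = \<rho> y * f y" "\<And>y. g (y + 1) = \<rho> y * g y"
    and "\<And>y. y < 0 \<Longrightarrow> \<rho> y \<noteq> 0"
  shows "f y = g y"
proof (induction y rule: int_induct[where k = 0])
  case base
  then show ?case using assms by simp
next
  case (step1 i)
  then show ?case using assms by simp
next
  case (step2 i)
  have "\<rho> (i - 1) * f (i - 1) = \<rho> (i - 1) * g (i - 1)"
    using step2 assms(2,3)[of "i - 1"] by simp
  then show ?case using step2 assms(4)[of "i - 1"] by simp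
qed

lemma gauss_rec: "z \<noteq> 0 \<Longrightarrow> gauss z (y + 1) = (z * q powi y) ^ 2 * q * gauss z y"
proof -
  assume z: "z \<noteq> 0"
  have "gauss z (y + 1) = z powi (y + y + 1 + 1) * q powi (y * y + y + y + 1)"
    unfolding gauss_def by (rule arg_cong2[where f = "(*)"]; rule arg_cong2[where f = power_int])
      (simp_all add: algebra_simps)
  also have "\<dots> = (z powi y * z powi y * z * z) * (q powi (y * y) * q powi y * q powi y * q)"
    using z q_nz by (simp only: power_int_add power_int_1_right disj_not1 simp_thms)
  also have "z powi y * z powi y = z powi (2 * y)"
    using z by (simp only: mult_2 power_int_add simp_thms)
  finally show ?thesis by (simp add: gauss_def power2_eq_square mult_ac)
qed

lemma gauss_0 [simp]: "gauss z 0 = 1"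
  by (simp add: gauss_def)

lemma qpair_rec:
  assumes "x \<noteq> 0"
  shows "qpair u (q * x) * (1 - q * u * x) = (1 - u / x) * qpair u x"
  using qpoch_inf_rec[of "q * u * x"] qpoch_inf_rec[of "u / x"] q_nz assms
  by (simp add: qpair_def mult_ac)

text \<open>Quasi-periodicity of theta(x) = (x)_inf (q/x)_inf: passing to q x exchanges the factor 1
  - x for 1 - 1/x.\<close>

lemma jacobi_theta_rec:
  assumes "x \<noteq> 0"
  shows "qpoch_inf q (q * x) * qpoch_inf q (1 / x) = - (1 / x) * (qpoch_inf q x * qpoch_inf q (q / x))"
proof -
  have 1: "qpoch_inf q x = (1 - x) * qpoch_inf q (q * x)" by (rule qpoch_inf_rec)
  have 2: "qpoch_inf q (1 / x) = (1 - 1 / x) * qpoch_inf q (q / x)"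
    using qpoch_inf_rec[of "1 / x"] by simp
  show ?thesis unfolding 1 2 using assms by (simp add: field_simps)
qed

lemma thdiff_theta:
  assumes "u \<noteq> 0" "x \<noteq> 0"
  shows "thdiff u x = u * (qpoch_inf q (x / u) * qpoch_inf q (q / (x / u)))
          * (qpoch_inf q (1 / (u * x)) * qpoch_inf q (q / (1 / (u * x))))"
proof -
  have "symp u - symp x = u * ((1 - x / u) * (1 - 1 / (u * x)))"
    using assms by (simp add: symp_def field_simps)
  then show ?thesis
    using qpoch_inf_rec[of "x / u"] qpoch_inf_rec[of "1 / (u * x)"]
    by (simp add: thdiff_def theta4_def qpair_def mult_ac)
qed

text \<open>Under x -> q x the two theta factors have multipliers -u/x and -1/(q u x). In their
  product 1/(q x^2) the parameter \<open>u\<close> has cancelled, so one Gaussian weight serves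
  every \<open>u\<close>.\<close>

lemma thdiff_rec:
  assumes "u \<noteq> 0" "x \<noteq> 0"
  shows "x ^ 2 * q * thdiff u (q * x) = thdiff u x"
proof -
  define A where "A = qpoch_inf q (x / u) * qpoch_inf q (q / (x / u))"
  \<comment> \<open>The second argument moves from 1/(u x) to 1/(q u x), so the recurrence is taken
    at the new point and read backwards.\<close>
  define B where "B = qpoch_inf q (1 / (q * u * x)) * qpoch_inf q (q / (1 / (q * u * x)))"
  have 1: "qpoch_inf q (q * (x / u)) * qpoch_inf q (1 / (x / u)) = - (1 / (x / u)) * A"
    unfolding A_def by (rule jacobi_theta_rec) (use assms in auto)
  have 2: "qpoch_inf q (q * (1 / (q * u * x))) * qpoch_inf q (1 / (1 / (q * u * x))) = - (1 / (1 / (q * u * x))) * B"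
    unfolding B_def by (rule jacobi_theta_rec) (use assms q_nz in auto)
  have "thdiff u (q * x) = u * (qpoch_inf q (q * (x / u)) * qpoch_inf q (1 / (x / u))) * B"
    using thdiff_theta[of u "q * x"] assms q_nz by (simp add: B_def mult_ac)
  also have "\<dots> = u * (- (1 / (x / u)) * A) * B" by (simp only: 1)
  finally have L: "thdiff u (q * x) = u * (- (1 / (x / u)) * A) * B" .
  have "thdiff u x = u * A * (qpoch_inf q (q * (1 / (q * u * x))) * qpoch_inf q (1 / (1 / (q * u * x))))"
    using thdiff_theta[of u x] assms q_nz by (simp add: A_def mult_ac)
  also have "\<dots> = u * A * (- (1 / (1 / (q * u * x))) * B)" by (simp only: 2)
  finally show ?thesis using L assms q_nz by (simp add: power2_eq_square field_simps)
qed

lemma thdiff_gauss: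
  assumes "u \<noteq> 0" "z \<noteq> 0"
  shows "thdiff u (z * q powi y) * gauss z y = thdiff u z"
proof -
  define f where "f y = thdiff u (z * q powi y) * gauss z y" for y
  have "f (i + 1) = f i" for i
  proof -
    define x where "x = z * q powi i"
    have "z * q powi (i + 1) = q * x"
      using q_nz by (simp add: x_def power_int_add)
    then have "f (i + 1) = (x ^ 2 * q * thdiff u (q * x)) * gauss z i"
      using assms by (simp add: f_def gauss_rec flip: x_def)
    also have "\<dots> = f i"
      using thdiff_rec[of u x] assms q_nz by (simp add: f_def x_def)
    finally show ?thesis .
  qed
  then have "f y = f 0"
    using int_recurrence_unique[of f "\<lambda>_. f 0" "\<lambda>_. 1" y] by simp
  then show ?thesis by (simp add: f_def)
qed

text \<open>Along an orbit \<open>thdiff u\<close> changes by nonzero factors only, so one nonzero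
  value keeps the whole orbit off its zeros.\<close>

lemma thdiff_nonzeroD:
  assumes "thdiff u z \<noteq> 0" "u \<noteq> 0" "z \<noteq> 0"
  shows "symp (z * q powi y) \<noteq> symp u"
  using thdiff_gauss[of u z y] assms by (auto simp: thdiff_def)

text \<open>A zero comes from a single factor of the four infinite products. Hence the zeros are
  countable, which later allows the choice of a pivot.\<close>

lemma thdiff_eq_0D:
  assumes "thdiff u x = 0" "u \<noteq> 0" "x \<noteq> 0"
  shows "\<exists>y. x = u * q powi y \<or> x * u = q powi y"
proof -
  from assms have "qpoch_inf q (x / u) = 0 \<or> qpoch_inf q (q / (x / u)) = 0 \<or>
      qpoch_inf q (1 / (u * x)) = 0 \<or> qpoch_inf q (q / (1 / (u * x))) = 0"
    by (simp add: thdiff_theta)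
  then obtain i where "x / u * q ^ i = 1 \<or> q / (x / u) * q ^ i = 1 \<or>
      1 / (u * x) * q ^ i = 1 \<or> q / (1 / (u * x)) * q ^ i = 1"
    by (auto simp: qpoch_inf_eq_0_iff)
  then have "x = u * (1 / q ^ i) \<or> x = u * (q * q ^ i) \<or> x * u = q ^ i \<or> x * u = 1 / (q * q ^ i)"
    using assms q_nz by (auto simp: field_simps)
  then show ?thesis
  proof (elim disjE)
    assume "x = u * (1 / q ^ i)"
    then show ?thesis
      by (intro exI[of _ "- int i"]) (simp add: power_int_minus inverse_eq_divide)
  next
    assume "x = u * (q * q ^ i)"
    then show ?thesis
      using q_nz by (intro exI[of _ "int i + 1"]) (simp add: power_int_add)
  next
    assume "x * u = q ^ i"
    then show ?thesis
      by (intro exI[of _ "int i"]) simp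
  next
    assume "x * u = 1 / (q * q ^ i)"
    then show ?thesis
      by (intro exI[of _ "- int (Suc i)"]) (simp only: power_int_minus power_int_of_nat, simp add: inverse_eq_divide)
  qed
qed

end

section \<open>Simple sums with Gaussian weight\<close>

text \<open>Lebesgue's theorem for the counting measure on \<open>A\<close>. It serves twice: for
  truncations of infinite products and for perturbations of \<open>a\<close>.\<close>

lemma has_sum_dominated_limit:
  fixes f :: "nat \<Rightarrow> 'a \<Rightarrow> complex"
  assumes "\<And>n. (f n has_sum S n) A" "\<And>n x. x \<in> A \<Longrightarrow> norm (f n x) \<le> g x"
    and "g summable_on A" "\<And>x. x \<in> A \<Longrightarrow> (\<lambda>n. f n x) \<longlonglongrightarrow> h x" "S \<longlonglongrightarrow> L"
  shows "(h has_sum L) A"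
proof -
  have g: "Infinite_Set_Sum.abs_summable_on g A"
    using iffD1[OF summable_on_iff_abs_summable_on_real assms(3)] iffD1[OF abs_summable_equivalent] by blast
  have h_le: "norm (h x) \<le> g x" if "x \<in> A" for x
    using LIMSEQ_le_const2[OF tendsto_norm[OF assms(4)[OF that]]] assms(2)[OF that] by blast
  have "(\<lambda>n. infsetsum (f n) A) \<longlonglongrightarrow> infsetsum h A"
    unfolding infsetsum_def
    by (rule integral_dominated_convergence[where w = g])
       (use g assms in \<open>auto simp: Infinite_Set_Sum.abs_summable_on_def AE_count_space\<close>)
  moreover have sf: "Infinite_Set_Sum.abs_summable_on (f n) A" for n
    using Infinite_Set_Sum.abs_summable_on_comparison_test'[OF g] assms(2) by blast
  then have "infsetsum (f n) A = S n" for n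
    using infsetsum_infsum[OF sf] infsumI[OF assms(1)] by simp
  ultimately have 1: "infsetsum h A = L"
    using LIMSEQ_unique assms(5) by auto
  have sh: "Infinite_Set_Sum.abs_summable_on h A"
    using Infinite_Set_Sum.abs_summable_on_comparison_test'[OF g] h_le by blast
  then have "h summable_on A"
    using abs_summable_equivalent abs_summable_summable by blast
  then show ?thesis
    using 1 infsetsum_infsum[OF sh] by (metis has_sum_infsum)
qed

lemma summable_on_int:
  fixes f :: "int \<Rightarrow> real"
  assumes "\<And>y. f y \<ge> 0" "summable (\<lambda>n. f (int n))" "summable (\<lambda>n. f (- int n))"
  shows "f summable_on UNIV"
proof -
  have "f summable_on range int"
    using assms by (subst summable_on_reindex) (auto simp: o_def summable_on_UNIV_nonneg_real_iff)
  moreover have "f summable_on range (\<lambda>n. - int n)"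
    using assms by (subst summable_on_reindex) (auto simp: o_def summable_on_UNIV_nonneg_real_iff inj_on_def)
  moreover have "range int \<union> range (\<lambda>n. - int n) = UNIV"
    by (auto simp: image_iff) (metis int_cases2)
  ultimately show ?thesis
    using summable_on_union by metis
qed

lemma has_sum_diff:
  fixes f g :: "'a \<Rightarrow> complex"
  assumes "(f has_sum a) A" "(g has_sum b) A"
  shows "((\<lambda>x. f x - g x) has_sum (a - b)) A"
  using has_sum_add[OF assms(1) has_sum_uminusI[OF assms(2)]] by simp

section \<open>Real majorants for the truncated products\<close>

context qbase
begin

text \<open>The product (-c; |q|)_inf as a real number. Defining it through \<open>qpoch_inf\<close>
  lets the lemmas of the locale be reused with base |q|.\<close>

definition psi :: "real \<Rightarrow> real" where
  "psi c = norm (qpoch_inf (of_real (norm q)) (- of_real c))"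

lemma qbase_norm: "qbase (of_real (norm q))"
  by standard (use q_nz q_lt in auto)

lemma psi_limit:
  assumes "c \<ge> 0"
  shows "(\<lambda>N. \<Prod>i<N. 1 + c * norm q ^ i) \<longlonglongrightarrow> psi c"
proof -
  have "(1 - (- of_real c) * of_real (norm q) ^ i :: complex) = of_real (1 + c * norm q ^ i)" for i
    by simp
  then have "norm (\<Prod>i<N. 1 - (- of_real c) * of_real (norm q) ^ i :: complex) = (\<Prod>i<N. 1 + c * norm q ^ i)" for N
    using assms by (simp only: prod_norm[symmetric] norm_of_real) (auto intro!: prod.cong abs_of_nonneg)
  then show ?thesis
    using tendsto_norm[OF qbase.qpoch_inf_limit[OF qbase_norm, of "- of_real c"]] by (simp add: psi_def)
qed

lemma psi_ge: "c \<ge> 0 \<Longrightarrow> (\<Prod>i<N. 1 + c * norm q ^ i) \<le> psi c"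
  by (rule incseq_le[OF _ psi_limit])
     (auto intro!: incseq_SucI mult_left_le simp: prod_nonneg mult_le_cancel_left1 distrib_left)

lemma psi_ge_1: "c \<ge> 0 \<Longrightarrow> psi c \<ge> 1"
  using psi_ge[of c 0] by simp

lemma psi_rec: "c \<ge> 0 \<Longrightarrow> psi c = (1 + c) * psi (norm q * c)"
proof -
  assume c: "c \<ge> 0"
  have "norm (1 + of_real c :: complex) = 1 + c"
    using c norm_of_real[of "1 + c"] by simp
  then show ?thesis
    using qbase.qpoch_inf_rec[OF qbase_norm, of "- of_real c"] by (simp add: psi_def norm_mult)
qed

lemma psi_0 [simp]: "psi 0 = 1"
  using qbase.qpoch_inf_0[OF qbase_norm] by (simp add: psi_def)

text \<open>Bounds, at points of modulus \<open>t\<close>, the product over \<open>gs\<close> times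
  any truncations of the two infinite products; the reals \<open>b\<close> and \<open>d\<close> are
  the moduli of their parameters.\<close>

definition majorant :: "complex list \<Rightarrow> real \<Rightarrow> real \<Rightarrow> real \<Rightarrow> real" where
  "majorant gs b d t = (\<Prod>u\<leftarrow>gs. (1 + norm u * t) * (1 + norm u / t)) *
     (psi (norm q * b * t) * psi (norm q * b / t)) * (psi (norm q * d * t) * psi (norm q * d / t))"

text \<open>From t to |q| t the first product loses a factor that is at least 1, and the second
  gains \<open>1 + b / t\<close>.\<close>

lemma psi_pair_rec_le:
  assumes "b \<ge> 0" "t > 0"
  shows "psi (norm q * b * (norm q * t)) * psi (norm q * b / (norm q * t))
    \<le> (1 + b / t) * (psi (norm q * b * t) * psi (norm q * b / t))"
proof -
  have "psi (norm q * b * (norm q * t)) \<le> psi (norm q * b * t)"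
    using psi_rec[of "norm q * b * t"] psi_ge_1[of "norm q * (norm q * b * t)"] assms
    by (simp add: mult_ac distrib_right)
  moreover have "psi (norm q * b / (norm q * t)) = (1 + b / t) * psi (norm q * b / t)"
    using psi_rec[of "b / t"] assms q_nz by simp
  moreover have "psi (norm q * b / t) \<ge> 0"
    by (simp add: psi_def)
  ultimately show ?thesis
    using assms mult_right_mono[of "psi (norm q * b * (norm q * t))" "psi (norm q * b * t)" "(1 + b / t) * psi (norm q * b / t)"]
    by (simp add: mult_ac)
qed

lemma prod_pair_rec_le:
  assumes "t > 0"
  shows "(\<Prod>u\<leftarrow>gs. (1 + norm u * (norm q * t)) * (1 + norm u / (norm q * t)))
    \<le> (1 / norm q) ^ length gs * (\<Prod>u\<leftarrow>gs. (1 + norm u * t) * (1 + norm u / t))"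
proof (induction gs)
  case (Cons u gs)
  have "1 + norm u * (norm q * t) \<le> 1 + norm u * t"
    using assms q_lt by (simp add: mult_left_le_one_le mult_left_mono)
  moreover have "1 + norm u / (norm q * t) \<le> (1 / norm q) * (1 + norm u / t)"
  proof -
    have "1 \<le> 1 / norm q"
      using q_lt q_nz by (simp add: le_divide_eq)
    moreover have "(1 / norm q) * (1 + norm u / t) = 1 / norm q + norm u / (norm q * t)"
      by (simp add: distrib_left)
    ultimately show ?thesis by linarith
  qed
  ultimately have "(1 + norm u * (norm q * t)) * (1 + norm u / (norm q * t))
      \<le> (1 + norm u * t) * ((1 / norm q) * (1 + norm u / t))"
    using assms by (intro mult_mono) auto
  then have "((1 + norm u * (norm q * t)) * (1 + norm u / (norm q * t))) *
      (\<Prod>u\<leftarrow>gs. (1 + norm u * (norm q * t)) * (1 + norm u / (norm q * t)))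
    \<le> ((1 + norm u * t) * ((1 / norm q) * (1 + norm u / t))) *
      ((1 / norm q) ^ length gs * (\<Prod>u\<leftarrow>gs. (1 + norm u * t) * (1 + norm u / t)))"
    using assms
    by (intro mult_mono[OF _ Cons.IH] mult_nonneg_nonneg prod_list_nonneg) (auto intro!: mult_nonneg_nonneg)
  then show ?case
    by (simp add: mult_ac)
qed simp

lemma majorant_nonneg: "t > 0 \<Longrightarrow> majorant gs b d t \<ge> 0"
  unfolding majorant_def
  by (intro mult_nonneg_nonneg prod_list_nonneg) (auto simp: psi_def)

lemma majorant_rec_le:
  assumes "b \<ge> 0" "d \<ge> 0" "t > 0"
  shows "majorant gs b d (norm q * t)
    \<le> (1 / norm q) ^ length gs * (1 + b / t) * (1 + d / t) * majorant gs b d t"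
proof -
  have nn: "psi c \<ge> 0" for c by (simp add: psi_def)
  have "majorant gs b d (norm q * t) \<le> 
     ((1 / norm q) ^ length gs * (\<Prod>u\<leftarrow>gs. (1 + norm u * t) * (1 + norm u / t))) *
     ((1 + b / t) * (psi (norm q * b * t) * psi (norm q * b / t))) *
     ((1 + d / t) * (psi (norm q * d * t) * psi (norm q * d / t)))"
    unfolding majorant_def
    by (rule mult_mono[OF mult_mono[OF prod_pair_rec_le psi_pair_rec_le] psi_pair_rec_le];
        (intro mult_nonneg_nonneg prod_list_nonneg)?)
       (use assms q_nz in \<open>auto intro!: mult_nonneg_nonneg nn\<close>)
  then show ?thesis
    by (simp add: majorant_def mult_ac)
qed

lemma majorant_inverse: "majorant gs b d (1 / t) = majorant gs b d t"
  by (simp add: majorant_def mult_ac)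

text \<open>Ratio test. The Gaussian factor t^2 |q| turns (1 + b/t)(1 + d/t) into |q| (t + b)(t +
  d), so the ratio bound \<open>\<rho>\<close> tends to the quantity assumed below 1 as t ->
  0.\<close>

lemma summable_majorant_nat:
  assumes "b \<ge> 0" "d \<ge> 0" "z \<noteq> 0" and "norm q * (1 / norm q) ^ length gs * (b * d) < 1"
  shows "summable (\<lambda>n. majorant gs b d (norm (z * q powi (int n))) * norm (gauss z (int n)))"
proof -
  define t where "t n = norm (z * q powi (int n))" for n :: nat
  define f where "f n = majorant gs b d (t n) * norm (gauss z (int n))" for n :: nat
  define \<rho> where "\<rho> x = norm q * (1 / norm q) ^ length gs * ((x + b) * (x + d))" for x
  have t: "t n = norm z * norm q ^ n" for n
    by (simp add: t_def norm_mult norm_power)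
  have t_pos: "t n > 0" for n
    using assms q_nz by (simp add: t)
  have f_rec: "f (Suc n) \<le> \<rho> (t n) * f n" for n
  proof -
    have g: "norm (gauss z (int (Suc n))) = t n ^ 2 * norm q * norm (gauss z (int n))"
      using gauss_rec[of z "int n"] assms by (simp add: t_def norm_mult norm_power add.commute)
    have "f (Suc n) = majorant gs b d (norm q * t n) * norm (gauss z (int (Suc n)))"
      by (simp add: f_def t mult_ac)
    also have "\<dots> \<le> ((1 / norm q) ^ length gs * (1 + b / t n) * (1 + d / t n) * majorant gs b d (t n)) *
        norm (gauss z (int (Suc n)))"
      by (intro mult_right_mono majorant_rec_le) (use assms t_pos in auto)
    also have "\<dots> = \<rho> (t n) * f n"
    proof -
      have h: "t n ^ 2 * ((1 + b / t n) * (1 + d / t n)) = (t n + b) * (t n + d)"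
        using t_pos[of n] by (simp add: field_simps power2_eq_square)
      then show ?thesis
        unfolding g \<rho>_def f_def h[symmetric] by (simp only: mult_ac)
    qed
    finally show ?thesis .
  qed
  have "t \<longlonglongrightarrow> norm z * 0"
    unfolding t using q_lt by (intro tendsto_mult_left LIMSEQ_power_zero) simp
  then have "(\<lambda>n. \<rho> (t n)) \<longlonglongrightarrow> norm q * (1 / norm q) ^ length gs * ((0 + b) * (0 + d))"
    unfolding \<rho>_def by (intro tendsto_intros) simp_all
  \<comment> \<open>Midpoint between the limit of the ratio bound and 1.\<close>
  moreover define c where "c = (1 + norm q * (1 / norm q) ^ length gs * (b * d)) / 2"
  ultimately have "\<forall>\<^sub>F n in sequentially. \<rho> (t n) < c"
    using assms by (intro order_tendstoD(2)) auto
  then obtain N where N: "\<And>n. n \<ge> N \<Longrightarrow> \<rho> (t n) < c"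
    unfolding eventually_sequentially by blast
  have f_nonneg: "f n \<ge> 0" for n
    using majorant_nonneg[OF t_pos] by (simp add: f_def)
  have "summable (\<lambda>n. f n)"
  proof (rule summable_ratio_test[where c = c and N = N])
    show "c < 1" using assms by (simp add: c_def)
    show "norm (f (Suc n)) \<le> c * norm (f n)" if "n \<ge> N" for n
      using f_rec[of n] mult_right_mono[OF less_imp_le[OF N[OF that]] f_nonneg[of n]] f_nonneg
      by simp
  qed
  then show ?thesis unfolding f_def t_def .
qed

lemma gauss_minus: "gauss z (- y) = gauss (1 / z) y"
  by (simp add: gauss_def power_int_minus power_int_divide_distrib inverse_eq_divide)

text \<open>Reversing \<open>y\<close> replaces \<open>z\<close> by 1/z and leaves the majorant
  unchanged, so both tails obey the same ratio condition.\<close>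

lemma summable_majorant:
  assumes "b \<ge> 0" "d \<ge> 0" "z \<noteq> 0" and "norm q * (1 / norm q) ^ length gs * (b * d) < 1"
  shows "(\<lambda>y. majorant gs b d (norm (z * q powi y)) * norm (gauss z y)) summable_on UNIV"
proof (rule summable_on_int)
  show "0 \<le> majorant gs b d (norm (z * q powi y)) * norm (gauss z y)" for y
    using majorant_nonneg[of "norm (z * q powi y)"] assms q_nz by simp
  show "summable (\<lambda>n. majorant gs b d (norm (z * q powi int n)) * norm (gauss z (int n)))"
    using summable_majorant_nat[OF assms] .
  have "majorant gs b d (norm (z * q powi - int n)) = majorant gs b d (norm (1 / z * q powi int n))" for n
    using majorant_inverse[of gs b d "norm (1 / z * q powi int n)"] 
    by (simp add: norm_mult norm_divide power_int_minus norm_power norm_inverse divide_inverse)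
  then show "summable (\<lambda>n. majorant gs b d (norm (z * q powi - int n)) * norm (gauss z (- int n)))"
    using summable_majorant_nat[of b d "1 / z" gs] assms by (simp add: gauss_minus)
qed

section \<open>Antisymmetric sums annihilated by the Gaussian weight\<close>

definition linprod :: "complex list \<Rightarrow> complex \<Rightarrow> complex" where
  "linprod gs x = (\<Prod>u\<leftarrow>gs. (1 - u * x) * (1 - u / x))"

lemma norm_linprod_le: "norm (linprod gs x) \<le> (\<Prod>u\<leftarrow>gs. (1 + norm u * norm x) * (1 + norm u / norm x))"
proof (induction gs)
  case (Cons u gs)
  have "norm (1 - u * x) \<le> 1 + norm u * norm x"
    using norm_triangle_ineq4[of 1 "u * x"] by (simp add: norm_mult)
  moreover have "norm (1 - u / x) \<le> 1 + norm u / norm x"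
    using norm_triangle_ineq4[of 1 "u / x"] by (simp add: norm_divide)
  ultimately have "norm ((1 - u * x) * (1 - u / x)) \<le> (1 + norm u * norm x) * (1 + norm u / norm x)"
    unfolding norm_mult by (intro mult_mono) auto
  then have "norm ((1 - u * x) * (1 - u / x)) * norm (linprod gs x) \<le>
      ((1 + norm u * norm x) * (1 + norm u / norm x)) * (\<Prod>u\<leftarrow>gs. (1 + norm u * norm x) * (1 + norm u / norm x))"
    by (intro mult_mono[OF _ Cons.IH]) (auto intro!: mult_nonneg_nonneg)
  then show ?case
    by (simp add: linprod_def norm_mult)
qed (simp add: linprod_def)

text \<open>A family containing \<open>asym\<close> (at j = 1) whose span is closed under
  multiplication by \<open>symp x\<close>; see \<open>asymj_symp\<close>.\<close>

definition asymj :: "int \<Rightarrow> complex \<Rightarrow> complex" where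
  "asymj j x = x powi (- j) - x powi j"

lemma summable_powi_gauss:
  assumes "z \<noteq> 0"
  shows "(\<lambda>y. (z * q powi y) powi j * gauss z y) summable_on UNIV"
proof -
  \<comment> \<open>Here |j| factors (1 + t)(1 + 1/t) dominate t^j, and \<open>b = d = 0\<close>
    makes the ratio condition trivial for every length of the list.\<close>
  define m where "m = nat \<bar>j\<bar>"
  have le: "norm (x powi j) \<le> majorant (replicate m 1) 0 0 (norm x)" if "x \<noteq> 0" for x :: complex
  proof -
    define t where "t = norm x"
    have t: "t > 0" using that by (simp add: t_def)
    have "t powi j \<le> ((1 + t) * (1 + 1 / t)) ^ m"
    proof (cases "j \<ge> 0")
      case True
      then have "t powi j = t ^ m" by (simp add: m_def power_int_def)
      moreover have "t \<le> (1 + t) * (1 + 1 / t)" using t by (simp add: field_simps)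
      ultimately show ?thesis using t by (simp add: power_mono)
    next
      case False
      then have "t powi j = (1 / t) ^ m" by (simp add: m_def power_int_def divide_inverse)
      moreover have "1 / t \<le> (1 + t) * (1 + 1 / t)" using t by (simp add: field_simps)
      ultimately show ?thesis using t by (simp add: power_mono)
    qed
    then show ?thesis
      by (simp add: majorant_def norm_power_int t_def)
  qed
  have "(\<lambda>y. norm ((z * q powi y) powi j * gauss z y)) summable_on UNIV"
  proof (rule Infinite_Sum.abs_summable_on_comparison_test')
    show "(\<lambda>y. majorant (replicate m 1) 0 0 (norm (z * q powi y)) * norm (gauss z y)) summable_on UNIV"
      using assms by (intro summable_majorant) auto
    show "norm ((z * q powi y) powi j * gauss z y) \<le>
        majorant (replicate m 1) 0 0 (norm (z * q powi y)) * norm (gauss z y)" for y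
      unfolding norm_mult[of "(z * q powi y) powi j"]
      by (intro mult_right_mono le) (use assms q_nz in auto)
  qed
  then show ?thesis by (rule abs_summable_summable)
qed

text \<open>Exponents: (y - j) j + (y - j)^2 = y^2 - j y for \<open>q\<close>, and j + 2 (y - j) = 2
  y - j for \<open>z\<close>.\<close>

lemma powi_gauss_shift:
  assumes "z \<noteq> 0"
  shows "(z * q powi (y - j)) powi j * gauss z (y - j) = (z * q powi y) powi (- j) * gauss z y"
proof -
  have "(z * q powi (y - j)) powi j * gauss z (y - j)
      = (z powi j * z powi (2 * (y - j))) * (q powi ((y - j) * j) * q powi ((y - j) * (y - j)))"
    by (simp only: gauss_def power_int_mult_distrib power_int_mult[of q "y - j" j, symmetric] mult_ac)
  also have "\<dots> = z powi (- j + 2 * y) * q powi (y * (- j) + y * y)"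
    using assms q_nz by (simp flip: power_int_add) (simp add: algebra_simps)
  also have "\<dots> = (z * q powi y) powi (- j) * gauss z y"
    using assms q_nz by (simp only: gauss_def power_int_mult_distrib power_int_mult power_int_add mult_ac disj_not1 simp_thms)
  finally show ?thesis .
qed

text \<open>
  The shift $y \mapsto y - j$ turns $x^j$ into $x^{-j}$ under the Gaussian weight, where
  $x = z q^y$.
\<close>

lemma has_sum_asymj_gauss:
  assumes "z \<noteq> 0"
  shows "((\<lambda>y. asymj j (z * q powi y) * gauss z y) has_sum 0) UNIV"
proof -
  define f where "f y = (z * q powi y) powi j * gauss z y" for y
  obtain S where S: "(f has_sum S) UNIV"
    using summable_powi_gauss[OF assms, of j] unfolding f_def summable_on_def by blast
  have "bij_betw (\<lambda>y::int. y - j) UNIV UNIV"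
    by (rule bij_betwI[of _ _ _ "\<lambda>y. y + j"]) auto
  from has_sum_reindex_bij_betw[OF this, of f S] S
  have "((\<lambda>y. f (y - j)) has_sum S) UNIV" by simp
  then have "((\<lambda>y. f (y - j) - f y) has_sum (S - S)) UNIV"
    using has_sum_diff S by blast
  then show ?thesis
    using powi_gauss_shift[OF assms, of _ j] by (simp add: f_def asymj_def left_diff_distrib)
qed

lemma asymj_symp: "x \<noteq> 0 \<Longrightarrow> symp x * asymj j x = asymj (j + 1) x + asymj (j - 1) x"
  by (simp add: symp_def asymj_def power_int_add power_int_diff power_int_minus field_simps)

text \<open>A linear factor is 1 + u^2 - u s with s = \<open>symp x\<close>, and s moves
  \<open>j\<close> by one in both directions; hence the induction keeps \<open>j\<close>
  arbitrary.\<close>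

lemma has_sum_asymj_linprod_gauss:
  assumes "z \<noteq> 0"
  shows "((\<lambda>y. asymj j (z * q powi y) * linprod gs (z * q powi y) * gauss z y) has_sum 0) UNIV"
proof (induction gs arbitrary: j)
  case Nil
  then show ?case using has_sum_asymj_gauss[OF assms] by (simp add: linprod_def)
next
  case (Cons u gs)
  define x where "x y = z * q powi y" for y
  have x: "x y \<noteq> 0" for y using assms q_nz by (simp add: x_def)
  define F where "F j y = asymj j (x y) * linprod gs (x y) * gauss z y" for j y
  have "((\<lambda>y. (1 + u ^ 2) * F j y - u * (F (j + 1) y + F (j - 1) y)) has_sum ((1 + u ^ 2) * 0 - u * (0 + 0))) UNIV"
    unfolding F_def x_def by (intro has_sum_diff has_sum_cmult_right has_sum_add Cons.IH)
  moreover have "(1 + u ^ 2) * F j y - u * (F (j + 1) y + F (j - 1) y)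
      = asymj j (x y) * linprod (u # gs) (x y) * gauss z y" for y
  proof -
    have 1: "F (j + 1) y + F (j - 1) y = (symp (x y) * asymj j (x y)) * linprod gs (x y) * gauss z y"
      by (simp add: F_def asymj_symp x distrib_right)
    have 2: "linprod (u # gs) (x y) = (1 + u ^ 2 - u * symp (x y)) * linprod gs (x y)"
      using linear_symp[OF x[of y], of u] by (simp add: linprod_def)
    show ?thesis unfolding 1 2 by (simp add: F_def algebra_simps)
  qed
  ultimately show ?case by (simp add: x_def)
qed

section \<open>The simple sum with denominator \<open>symp x - symp a\<close>\<close>

definition kernel :: "complex \<Rightarrow> complex \<Rightarrow> complex" where
  "kernel a x = asym x / (symp x - symp a)"

text \<open>\<open>asym x\<close> differs from \<open>symp x\<close> by 2 x and from its negative by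
  2/x, and one of x, 1/x has modulus at most 1.\<close>

lemma norm_asym_le: "norm (asym x) \<le> norm (symp x) + 2"
proof (cases "norm x \<le> 1")
  case True
  have "norm (asym x) \<le> norm (symp x) + norm (2 * x)"
    using norm_triangle_ineq4[of "symp x" "2 * x"] by (simp add: asym_def symp_def)
  then show ?thesis using True by (simp add: norm_mult)
next
  case False
  have "norm (asym x) \<le> norm (2 / x) + norm (symp x)"
    using norm_triangle_ineq4[of "2 / x" "symp x"] by (simp add: asym_def symp_def)
  moreover have "norm (2 / x) \<le> 2" using False by (simp add: norm_divide divide_le_eq)
  ultimately show ?thesis by simp
qed

text \<open>At either end of the orbit x or 1/x tends to 0, so \<open>symp\<close> is unbounded
  there.\<close>

lemma finite_orbit_symp_le:
  assumes "z \<noteq> 0"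
  shows "finite {y. norm (symp (z * q powi y)) \<le> B}"
proof -
  have lim: "(\<lambda>n. norm w * norm q ^ n) \<longlonglongrightarrow> 0" for w :: complex
    using tendsto_mult_right_zero[OF LIMSEQ_power_zero[of "norm q"]] q_lt by simp
  have bound: "1 / norm x \<le> norm (symp x) + 1" if "norm x \<le> 1" for x
    using norm_triangle_ineq4[of "symp x" x] that by (simp add: symp_def norm_divide)
  have ev: "\<forall>\<^sub>F n in sequentially. norm (symp (w * q ^ n)) > B" if "w \<noteq> 0" for w
  proof -
    have "\<forall>\<^sub>F n in sequentially. norm w * norm q ^ n < 1 / (\<bar>B\<bar> + 2)"
      by (rule order_tendstoD(2)[OF lim]) auto
    then show ?thesis
    proof eventually_elim
      case (elim n)
      define t where "t = norm (w * q ^ n)"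
      have t: "t > 0" "t < 1 / (\<bar>B\<bar> + 2)"
        using elim that q_nz by (auto simp: t_def norm_mult norm_power)
      then have "1 / t > \<bar>B\<bar> + 2" by (simp add: field_simps)
      moreover have "t \<le> 1" using t by (smt (verit) divide_le_eq_1)
      ultimately show ?case using bound[of "w * q ^ n"] by (simp add: t_def)
    qed
  qed
  have inv: "symp (z * q powi (- int n)) = symp (1 / z * q ^ n)" for n
    by (simp add: symp_def power_int_minus field_simps)
  obtain N1 N2 where N: "\<And>n. n \<ge> N1 \<Longrightarrow> norm (symp (z * q ^ n)) > B"
      "\<And>n. n \<ge> N2 \<Longrightarrow> norm (symp (1 / z * q ^ n)) > B"
    using ev[of z] ev[of "1 / z"] assms unfolding eventually_sequentially by auto
  have "{y. norm (symp (z * q powi y)) \<le> B} \<subseteq> {- int N2..int N1}"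
  proof (intro subsetI CollectI)
    fix y assume y: "y \<in> {y. norm (symp (z * q powi y)) \<le> B}"
    show "y \<in> {- int N2..int N1}"
    proof (cases y rule: int_cases2)
      case (nonneg n)
      then have "\<not> n \<ge> N1" using N(1)[of n] y by auto
      then show ?thesis using nonneg by simp
    next
      case (nonpos n)
      then have "\<not> n \<ge> N2" using N(2)[of n] y inv[of n] by auto
      then show ?thesis using nonpos by simp
    qed
  qed
  then show ?thesis by (rule finite_subset) simp
qed

text \<open>Outside a finite set of indices the distance is at least 1; inside, a minimum
  exists.\<close>

lemma orbit_gap:
  assumes "z \<noteq> 0" "\<And>y. symp (z * q powi y) \<noteq> s"
  obtains \<delta> where "\<delta> > 0" "\<And>y. norm (symp (z * q powi y) - s) \<ge> \<delta>"
proof -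
  define Y where "Y = {y. norm (symp (z * q powi y)) \<le> norm s + 1}"
  define \<delta> where "\<delta> = Min (insert 1 ((\<lambda>y. norm (symp (z * q powi y) - s)) ` Y))"
  have fin: "finite Y" using finite_orbit_symp_le[OF assms(1)] by (simp add: Y_def)
  show ?thesis
  proof
    show "\<delta> > 0" using fin assms(2) by (simp add: \<delta>_def)
    show "norm (symp (z * q powi y) - s) \<ge> \<delta>" for y
    proof (cases "y \<in> Y")
      case True
      then show ?thesis using fin by (auto simp: \<delta>_def intro: Min_le)
    next
      case False
      then have "norm (symp (z * q powi y) - s) \<ge> 1"
        using norm_triangle_ineq2[of "symp (z * q powi y)" s] by (simp add: Y_def)
      moreover have "\<delta> \<le> 1" using fin by (simp add: \<delta>_def)
      ultimately show ?thesis by simp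
    qed
  qed
qed

lemma kernel_bounded:
  assumes "z \<noteq> 0" "\<And>y. symp (z * q powi y) \<noteq> symp a"
  obtains C where "C > 0" "\<And>y. norm (kernel a (z * q powi y)) \<le> C"
proof -
  obtain \<delta> where \<delta>: "\<delta> > 0" "\<And>y. norm (symp (z * q powi y) - symp a) \<ge> \<delta>"
    using orbit_gap[OF assms] by blast
  \<comment> \<open>The numerator is at most w + |symp a| + 2 with w the modulus of the denominator,
    and w >= \<open>\<delta>\<close> bounds the last two terms by a multiple of w.\<close>
  define C where "C = 1 + (norm (symp a) + 2) / \<delta>"
  show ?thesis
  proof
    show "C > 0" using \<delta>(1) by (simp add: C_def add_pos_nonneg)
    show "norm (kernel a (z * q powi y)) \<le> C" for y
    proof -
      define w where "w = norm (symp (z * q powi y) - symp a)"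
      have w: "w \<ge> \<delta>" using \<delta>(2) by (simp add: w_def)
      have "norm (asym (z * q powi y)) \<le> w + norm (symp a) + 2"
        using norm_asym_le[of "z * q powi y"] norm_triangle_sub[of "symp (z * q powi y)" "symp a"]
        by (simp add: w_def)
      also have "norm (symp a) + 2 \<le> (norm (symp a) + 2) / \<delta> * w"
        using w \<delta>(1) by (simp add: pos_le_divide_eq mult_left_mono)
      then have "w + norm (symp a) + 2 \<le> C * w"
        by (simp add: C_def algebra_simps)
      finally have "norm (asym (z * q powi y)) \<le> C * w" .
      then show ?thesis
        using w \<delta>(1) by (simp add: kernel_def norm_divide divide_le_eq flip: w_def)
    qed
  qed
qed

definition ksum :: "complex \<Rightarrow> complex \<Rightarrow> complex" where
  "ksum z a = (\<Sum>\<^sub>\<infinity>y. kernel a (z * q powi y) * gauss z y)"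

text \<open>Serves two ends: with \<open>q * b\<close> it truncates \<open>qpair b\<close>, and with
  \<open>c j\<close> and \<open>m j\<close> it gives the finite products of the theorem.\<close>

definition linlist :: "complex \<Rightarrow> nat \<Rightarrow> complex list" where
  "linlist b N = map (\<lambda>i. b * q ^ i) [0..<N]"

lemma linprod_append: "linprod (gs @ hs) x = linprod gs x * linprod hs x"
  by (simp add: linprod_def)

lemma linprod_linlist: "linprod (linlist b N) x = (\<Prod>i<N. 1 - (b * x) * q ^ i) * (\<Prod>i<N. 1 - (b / x) * q ^ i)"
proof -
  have "linprod (linlist b N) x = (\<Prod>i<N. (1 - (b * x) * q ^ i) * (1 - (b / x) * q ^ i))"
    by (simp add: linprod_def linlist_def o_def interv_sum_list_conv_sum_set_nat prod.list_conv_set_nth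
        atLeast0LessThan mult_ac)
  then show ?thesis by (simp add: prod.distrib)
qed

lemma linprod_linlist_limit: "(\<lambda>N. linprod (linlist (q * b) N) x) \<longlonglongrightarrow> qpair b x"
  unfolding linprod_linlist qpair_def by (intro tendsto_mult qpoch_inf_limit)

lemma norm_linlist_le:
  assumes "x \<noteq> 0"
  shows "norm (linprod (linlist (q * b) N) x) \<le> psi (norm q * norm b * norm x) * psi (norm q * norm b / norm x)"
proof -
  have *: "norm (\<Prod>i<N. 1 - c * q ^ i) \<le> psi (norm c)" for c
  proof -
    have "norm (\<Prod>i<N. 1 - c * q ^ i) \<le> (\<Prod>i<N. 1 + norm c * norm q ^ i)"
      unfolding prod_norm[symmetric]
    proof (rule prod_mono, intro conjI)
      show "norm (1 - c * q ^ i) \<le> 1 + norm c * norm q ^ i" for i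
        using norm_triangle_ineq4[of 1 "c * q ^ i"] by (simp add: norm_mult norm_power)
    qed simp
    also have "\<dots> \<le> psi (norm c)" by (rule psi_ge) simp
    finally show ?thesis .
  qed
  have "norm (linprod (linlist (q * b) N) x) \<le> psi (norm (q * b * x)) * psi (norm (q * b / x))"
    unfolding linprod_linlist norm_mult[of "prod _ _"] by (intro mult_mono *) (auto simp: psi_def)
  then show ?thesis by (simp add: norm_mult norm_divide)
qed

context
  fixes z a :: complex
  assumes z_nz: "z \<noteq> 0" and a_nz: "a \<noteq> 0"
    and off_orbit: "\<And>y. symp (z * q powi y) \<noteq> symp a"
begin

lemma has_sum_kernel_gauss: "((\<lambda>y. kernel a (z * q powi y) * gauss z y) has_sum ksum z a) UNIV"
proof -
  obtain C where C: "C > 0" "\<And>y. norm (kernel a (z * q powi y)) \<le> C"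
    using kernel_bounded[OF z_nz off_orbit] by blast
  have "gauss z summable_on UNIV"
    using summable_powi_gauss[OF z_nz, of 0] by simp
  then have "(\<lambda>y. norm (gauss z y)) summable_on UNIV"
    by (rule iffD1[OF summable_on_iff_abs_summable_on_complex])
  then have "(\<lambda>y. C * norm (gauss z y)) summable_on UNIV"
    by (rule summable_on_cmult_right)
  then have "(\<lambda>y. norm (kernel a (z * q powi y) * gauss z y)) summable_on UNIV"
    by (rule Infinite_Sum.abs_summable_on_comparison_test')
       (use C in \<open>auto simp: norm_mult intro!: mult_right_mono\<close>)
  then show ?thesis
    unfolding ksum_def by (rule has_sum_infsum[OF abs_summable_summable])
qed

text \<open>Each linear factor in \<open>symp x\<close> may be evaluated at \<open>a\<close>: the difference cancels the denominator.\<close>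

lemma has_sum_kernel_linprod:
  "((\<lambda>y. kernel a (z * q powi y) * linprod gs (z * q powi y) * gauss z y)
    has_sum (linprod gs a * ksum z a)) UNIV"
proof (induction gs)
  case Nil
  then show ?case using has_sum_kernel_gauss by (simp add: linprod_def)
next
  case (Cons u gs)
  define x where "x y = z * q powi y" for y
  have x: "x y \<noteq> 0" for y using z_nz q_nz by (simp add: x_def)
  have "((\<lambda>y. (1 - u * a) * (1 - u / a) * (kernel a (x y) * linprod gs (x y) * gauss z y)
      - u * (asymj 1 (x y) * linprod gs (x y) * gauss z y))
      has_sum ((1 - u * a) * (1 - u / a) * (linprod gs a * ksum z a) - u * 0)) UNIV"
    unfolding x_def
    by (intro has_sum_diff has_sum_cmult_right Cons.IH has_sum_asymj_linprod_gauss z_nz)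
  moreover have "(1 - u * a) * (1 - u / a) * (kernel a (x y) * linprod gs (x y) * gauss z y)
      - u * (asymj 1 (x y) * linprod gs (x y) * gauss z y)
      = kernel a (x y) * linprod (u # gs) (x y) * gauss z y" for y
  proof -
    have k: "asymj 1 (x y) = kernel a (x y) * (symp (x y) - symp a)"
      using off_orbit[of y] by (simp add: kernel_def asymj_def asym_def x_def power_int_minus inverse_eq_divide)
    have l: "linprod (u # gs) (x y) = (1 + u ^ 2 - u * symp (x y)) * linprod gs (x y)"
      using linear_symp[OF x[of y], of u] by (simp add: linprod_def)
    show ?thesis unfolding k l linear_symp[OF a_nz] by (simp add: algebra_simps)
  qed
  ultimately show ?case by (simp add: x_def linprod_def mult_ac)
qed

text \<open>Every truncation is a finite list and is evaluated exactly by
  \<open>has_sum_kernel_linprod\<close>. The bounded kernel times \<open>majorant\<close> dominates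
  all truncations, so both sides pass to the limit.\<close>

proposition has_sum_kernel_qpair:
  assumes conv: "norm q * (1 / norm q) ^ length gs * (norm b * norm d) < 1"
  shows "((\<lambda>y. kernel a (z * q powi y) * (linprod gs (z * q powi y) * qpair b (z * q powi y) * qpair d (z * q powi y))
       * gauss z y) has_sum (linprod gs a * qpair b a * qpair d a * ksum z a)) UNIV"
proof -
  obtain C where C: "C > 0" "\<And>y. norm (kernel a (z * q powi y)) \<le> C"
    using kernel_bounded[OF z_nz off_orbit] by blast
  define Q where "Q N = linprod (gs @ linlist (q * b) N @ linlist (q * d) N)" for N
  have lim: "(\<lambda>N. Q N x) \<longlonglongrightarrow> linprod gs x * qpair b x * qpair d x" for x
    unfolding Q_def linprod_append mult.assoc by (intro tendsto_mult tendsto_const linprod_linlist_limit)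
  have bound: "norm (Q N x) \<le> majorant gs (norm b) (norm d) (norm x)" if x: "x \<noteq> 0" for N x
  proof -
    have nn: "psi c \<ge> 0" for c by (simp add: psi_def)
    have "norm (Q N x) = norm (linprod gs x) * norm (linprod (linlist (q * b) N) x) * norm (linprod (linlist (q * d) N) x)"
      by (simp add: Q_def linprod_append norm_mult)
    also have "\<dots> \<le> majorant gs (norm b) (norm d) (norm x)"
      unfolding majorant_def
      by (rule mult_mono[OF mult_mono[OF norm_linprod_le norm_linlist_le[OF x]] norm_linlist_le[OF x]];
          (intro mult_nonneg_nonneg prod_list_nonneg nn)?) (auto intro!: mult_nonneg_nonneg)
    finally show ?thesis .
  qed
  show ?thesis
  proof (rule has_sum_dominated_limit)
    show "((\<lambda>y. kernel a (z * q powi y) * Q N (z * q powi y) * gauss z y) has_sum (Q N a * ksum z a)) UNIV" for N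
      unfolding Q_def by (rule has_sum_kernel_linprod)
    show "norm (kernel a (z * q powi y) * Q N (z * q powi y) * gauss z y)
        \<le> C * (majorant gs (norm b) (norm d) (norm (z * q powi y)) * norm (gauss z y))" for N y
    proof -
      have "norm (kernel a (z * q powi y)) * norm (Q N (z * q powi y))
          \<le> C * majorant gs (norm b) (norm d) (norm (z * q powi y))"
        using C z_nz q_nz by (intro mult_mono bound) auto
      then have "norm (kernel a (z * q powi y)) * norm (Q N (z * q powi y)) * norm (gauss z y)
          \<le> C * majorant gs (norm b) (norm d) (norm (z * q powi y)) * norm (gauss z y)"
        by (rule mult_right_mono) simp
      then show ?thesis by (simp add: norm_mult mult.assoc)
    qed
    show "(\<lambda>y. C * (majorant gs (norm b) (norm d) (norm (z * q powi y)) * norm (gauss z y))) summable_on UNIV"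
      by (rule summable_on_cmult_right, rule summable_majorant) (use z_nz conv in auto)
    show "(\<lambda>N. kernel a (z * q powi y) * Q N (z * q powi y) * gauss z y) \<longlonglongrightarrow>
       kernel a (z * q powi y) * (linprod gs (z * q powi y) * qpair b (z * q powi y) * qpair d (z * q powi y))
       * gauss z y" for y
      by (intro tendsto_mult tendsto_const lim)
    show "(\<lambda>N. Q N a * ksum z a) \<longlonglongrightarrow> linprod gs a * qpair b a * qpair d a * ksum z a"
      by (intro tendsto_mult tendsto_const lim)
  qed
qed

end

end

section \<open>Determinants and the generic multiple sum\<close>

lemma prod_square:
  fixes F :: "nat \<Rightarrow> nat \<Rightarrow> complex"
  shows "(\<Prod>j=1..n. \<Prod>k=1..n. F j k) = (\<Prod>k=1..n. F k k) * (\<Prod>k=1..n. \<Prod>j=1..<k. F j k * F k j)"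
proof (induction n)
  case (Suc n)
  have "(\<Prod>j=1..Suc n. \<Prod>k=1..Suc n. F j k)
      = (\<Prod>j=1..n. \<Prod>k=1..n. F j k) * (\<Prod>j=1..n. F j (Suc n)) * ((\<Prod>k=1..n. F (Suc n) k) * F (Suc n) (Suc n))"
    by (simp add: prod.distrib mult_ac)
  then show ?case
    unfolding Suc.IH by (simp add: prod.distrib atLeastLessThanSuc_atLeastAtMost mult_ac)
qed simp

lemma det_scale_rows_cols:
  fixes f :: "nat \<Rightarrow> nat \<Rightarrow> complex"
  shows "det (mat n n (\<lambda>(i, j). r i * c j * f i j)) = (\<Prod>i<n. r i) * (\<Prod>i<n. c i) * det (mat n n (\<lambda>(i, j). f i j))"
proof -
  have "(\<Prod>i=0..<n. mat n n (\<lambda>(i, j). r i * c j * f i j) $$ (i, p i))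
      = (\<Prod>i<n. r i) * (\<Prod>i<n. c i) * (\<Prod>i=0..<n. mat n n (\<lambda>(i, j). f i j) $$ (i, p i))"
    if p: "p permutes {0..<n}" for p
  proof -
    have "p i < n" if "i < n" for i
      using permutes_in_image[OF p] that by simp
    then have "(\<Prod>i=0..<n. mat n n (\<lambda>(i, j). r i * c j * f i j) $$ (i, p i))
        = (\<Prod>i=0..<n. r i * c (p i) * mat n n (\<lambda>(i, j). f i j) $$ (i, p i))"
      by (intro prod.cong) auto
    moreover have "(\<Prod>i=0..<n. c (p i)) = (\<Prod>i=0..<n. c i)"
      using prod.permute[OF p, of c] by (simp add: o_def)
    ultimately show ?thesis
      by (simp add: prod.distrib atLeast0LessThan)
  qed
  then show ?thesis
    by (simp add: det_def sum_distrib_left mult_ac)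
qed

text \<open>Schur complement of the corner entry, by column operations.\<close>

lemma det_bordered:
  fixes f :: "nat \<Rightarrow> nat \<Rightarrow> complex"
  assumes "f n n \<noteq> 0"
  shows "det (mat (Suc n) (Suc n) (\<lambda>(i, j). f i j))
    = det (mat n n (\<lambda>(i, j). f i j - f i n * f n j / f n n)) * f n n"
proof -
  define A where "A = mat n n (\<lambda>(i, j). f i j)"
  define U where "U = mat n 1 (\<lambda>(i, j). f i n)"
  define V where "V = mat 1 n (\<lambda>(i, j). f n j)"
  define W where "W = mat 1 1 (\<lambda>(i::nat, j::nat). f n n)"
  \<comment> \<open>The multiples of the last column that clear the rest of the last row.\<close>
  define V' where "V' = mat 1 n (\<lambda>(i, j). - f n j / f n n)"
  have c: "A \<in> carrier_mat n n" "U \<in> carrier_mat n 1" "V \<in> carrier_mat 1 n" "W \<in> carrier_mat 1 1" "V' \<in> carrier_mat 1 n"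
    by (auto simp: A_def U_def V_def W_def V'_def)
  have M: "mat (Suc n) (Suc n) (\<lambda>(i, j). f i j) = four_block_mat A U V W"
    by (rule eq_matI) (auto simp: A_def U_def V_def W_def less_Suc_eq)
  define L where "L = four_block_mat (1\<^sub>m n) (0\<^sub>m n 1) V' (1\<^sub>m 1)"
  have det_L: "det L = 1"
    unfolding L_def by (subst det_four_block_mat_upper_right_zero[of _ n _ 1]) (use c in auto)
  have "four_block_mat A U V W * L = four_block_mat
      (A * 1\<^sub>m n + U * V') (A * 0\<^sub>m n 1 + U * 1\<^sub>m 1) (V * 1\<^sub>m n + W * V') (V * 0\<^sub>m n 1 + W * 1\<^sub>m 1)"
    unfolding L_def by (rule mult_four_block_mat[of _ n n _ 1 _ 1 _ _ n _ 1]) (use c in auto)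
  moreover have "A * 1\<^sub>m n + U * V' = mat n n (\<lambda>(i, j). f i j - f i n * f n j / f n n)"
    by (rule eq_matI) (auto simp: A_def U_def V'_def scalar_prod_def)
  moreover have "A * 0\<^sub>m n 1 + U * 1\<^sub>m 1 = U" "V * 0\<^sub>m n 1 + W * 1\<^sub>m 1 = W"
    using c by auto
  moreover have "V * 1\<^sub>m n + W * V' = 0\<^sub>m 1 n"
    using assms by (intro eq_matI) (auto simp: V_def W_def V'_def scalar_prod_def)
  ultimately have "four_block_mat A U V W * L =
      four_block_mat (mat n n (\<lambda>(i, j). f i j - f i n * f n j / f n n)) U (0\<^sub>m 1 n) W"
    by simp
  then have "det (four_block_mat A U V W * L) = det (mat n n (\<lambda>(i, j). f i j - f i n * f n j / f n n)) * det W"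
    using det_four_block_mat_lower_left_zero[of "mat n n (\<lambda>(i, j). f i j - f i n * f n j / f n n)" n U 1 "0\<^sub>m 1 n" W] c
    by simp
  moreover have "det (four_block_mat A U V W * L) = det (four_block_mat A U V W) * det L"
    by (rule det_mult[of _ "n + 1"]) (use c in \<open>auto simp: L_def\<close>)
  moreover have "det W = f n n"
    by (subst det_single) (auto simp: W_def)
  ultimately show ?thesis using det_L M by simp
qed

text \<open>Pivoting on the last entry: the Schur complement of a Cauchy matrix is the smaller
  Cauchy matrix with rows scaled by \<open>r\<close> and columns by \<open>c\<close>.\<close>

lemma cauchy_det:
  fixes X \<alpha> :: "nat \<Rightarrow> complex"
  assumes "\<And>i j. i < n \<Longrightarrow> j < n \<Longrightarrow> X i \<noteq> \<alpha> j"
  shows "det (mat n n (\<lambda>(i, j). 1 / (X i - \<alpha> j)))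
    = (\<Prod>k<n. \<Prod>j<k. (X k - X j) * (\<alpha> j - \<alpha> k)) / (\<Prod>i<n. \<Prod>j<n. X i - \<alpha> j)"
  using assms
proof (induction n)
  case 0
  then show ?case by (simp add: det_def)
next
  case (Suc n)
  define r where "r i = (X i - X n) / (X i - \<alpha> n)" for i
  define c where "c j = (\<alpha> n - \<alpha> j) / (X n - \<alpha> j)" for j
  have nz: "X i - \<alpha> j \<noteq> 0" if "i < Suc n" "j < Suc n" for i j
    using Suc.prems[OF that] by simp
  have entry: "1 / (X i - \<alpha> j) - 1 / (X i - \<alpha> n) * (1 / (X n - \<alpha> j)) / (1 / (X n - \<alpha> n))
      = r i * c j * (1 / (X i - \<alpha> j))" if "i < n" "j < n" for i j
    using nz[of i j] nz[of i n] nz[of n j] nz[of n n] that unfolding r_def c_def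
    by (simp add: divide_simps) (simp add: algebra_simps)
  have "det (mat (Suc n) (Suc n) (\<lambda>(i, j). 1 / (X i - \<alpha> j)))
      = det (mat n n (\<lambda>(i, j). 1 / (X i - \<alpha> j) - 1 / (X i - \<alpha> n) * (1 / (X n - \<alpha> j)) / (1 / (X n - \<alpha> n)))) * (1 / (X n - \<alpha> n))"
    by (rule det_bordered[of "\<lambda>i j. 1 / (X i - \<alpha> j)"]) (use nz[of n n] in simp)
  also have "mat n n (\<lambda>(i, j). 1 / (X i - \<alpha> j) - 1 / (X i - \<alpha> n) * (1 / (X n - \<alpha> j)) / (1 / (X n - \<alpha> n)))
      = mat n n (\<lambda>(i, j). r i * c j * (1 / (X i - \<alpha> j)))"
    by (rule cong_mat) (simp_all only: case_prod_conv entry)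
  also have "det \<dots> = (\<Prod>i<n. r i) * (\<Prod>i<n. c i) *
      ((\<Prod>k<n. \<Prod>j<k. (X k - X j) * (\<alpha> j - \<alpha> k)) / (\<Prod>i<n. \<Prod>j<n. X i - \<alpha> j))"
    by (subst det_scale_rows_cols, subst Suc.IH) (use Suc.prems in auto)
  also have "(\<Prod>i<n. r i) * (\<Prod>i<n. c i) = (\<Prod>j<n. (X n - X j) * (\<alpha> j - \<alpha> n)) / ((\<Prod>i<n. X i - \<alpha> n) * (\<Prod>j<n. X n - \<alpha> j))"
    unfolding r_def c_def prod_dividef prod.distrib[symmetric]
      times_divide_times_eq
    by (intro arg_cong2[where f = "(/)"] prod.cong refl) (simp_all add: algebra_simps)
  finally show ?case
    by (simp add: prod.distrib mult_ac)
qed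

text \<open>The Leibniz form is wanted because each of its terms factors over the variables and can
  be summed one variable at a time. \<open>Suc (p (k - 1))\<close> transports a permutation of 0,
  ..., n-1 to the indices 1, ..., n.\<close>

lemma cauchy_expansion:
  fixes X \<alpha> :: "nat \<Rightarrow> complex"
  assumes "\<And>i j. i \<in> {1..n} \<Longrightarrow> j \<in> {1..n} \<Longrightarrow> X i \<noteq> \<alpha> j"
  shows "(\<Sum>p | p permutes {0..<n}. signof p * (\<Prod>k=1..n. 1 / (X k - \<alpha> (Suc (p (k - 1))))))
    = (\<Prod>k=1..n. \<Prod>j=1..<k. (X k - X j) * (\<alpha> j - \<alpha> k)) / (\<Prod>k=1..n. \<Prod>j=1..n. X k - \<alpha> j)"
proof -
  define X' where "X' = X \<circ> Suc"
  define \<alpha>' where "\<alpha>' = \<alpha> \<circ> Suc"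
  have shift: "(\<Prod>k=1..n. f k) = (\<Prod>k<n. f (Suc k))" for f :: "nat \<Rightarrow> complex"
    by (simp add: prod.atLeast1_atMost_eq)
  have shift': "(\<Prod>j=1..<Suc k. f j) = (\<Prod>j<k. f (Suc j))" for f :: "nat \<Rightarrow> complex" and k
    by (simp add: prod.atLeast1_atMost_eq atLeastLessThanSuc_atLeastAtMost)
  have "(\<Sum>p | p permutes {0..<n}. signof p * (\<Prod>k=1..n. 1 / (X k - \<alpha> (Suc (p (k - 1))))))
      = det (mat n n (\<lambda>(i, j). 1 / (X' i - \<alpha>' j)))"
    unfolding det_def shift
    by (auto simp: X'_def \<alpha>'_def atLeast0LessThan permutes_in_image intro!: sum.cong prod.cong)
  also have "\<dots> = (\<Prod>k<n. \<Prod>j<k. (X' k - X' j) * (\<alpha>' j - \<alpha>' k)) / (\<Prod>i<n. \<Prod>j<n. X' i - \<alpha>' j)"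
    by (rule cauchy_det) (use assms in \<open>auto simp: X'_def \<alpha>'_def\<close>)
  finally show ?thesis
    by (simp only: shift shift' X'_def \<alpha>'_def o_def)
qed

lemma has_sum_sum_complex:
  fixes f :: "'i \<Rightarrow> 'a \<Rightarrow> complex"
  assumes "finite I" "\<And>i. i \<in> I \<Longrightarrow> (f i has_sum S i) A"
  shows "((\<lambda>x. \<Sum>i\<in>I. f i x) has_sum (\<Sum>i\<in>I. S i)) A"
  using assms by (induction I rule: finite_induct) (auto intro!: has_sum_add)

text \<open>Unconditional convergence of complex series is absolute, so the product of the series
  may be expanded over tuples.\<close>

lemma has_sum_prod_PiE:
  fixes f :: "'i \<Rightarrow> 'a :: countable \<Rightarrow> complex"
  assumes "finite K" "\<And>k. k \<in> K \<Longrightarrow> (f k has_sum S k) UNIV"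
  shows "((\<lambda>y. \<Prod>k\<in>K. f k (y k)) has_sum (\<Prod>k\<in>K. S k)) (PiE K (\<lambda>_. UNIV))"
proof -
  have s: "Infinite_Sum.abs_summable_on (f k) UNIV" if "k \<in> K" for k
    using has_sum_imp_summable[OF assms(2)[OF that]] by (rule iffD1[OF summable_on_iff_abs_summable_on_complex])
  then have "Infinite_Set_Sum.abs_summable_on (\<lambda>y. \<Prod>k\<in>K. f k (y k)) (PiE K (\<lambda>_. UNIV))"
    by (intro abs_summable_on_prod_PiE assms(1)) (simp_all flip: abs_summable_equivalent)
  then have "(\<lambda>y. \<Prod>k\<in>K. f k (y k)) summable_on (PiE K (\<lambda>_. UNIV))"
    using abs_summable_equivalent abs_summable_summable by blast
  moreover have "infsum (\<lambda>y. \<Prod>k\<in>K. f k (y k)) (PiE K (\<lambda>_. UNIV)) = (\<Prod>k\<in>K. infsum (f k) UNIV)"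
    by (rule infsum_prod_PiE_abs[OF assms(1) s])
  moreover have "(\<Prod>k\<in>K. infsum (f k) UNIV) = (\<Prod>k\<in>K. S k)"
    by (intro prod.cong refl infsumI assms(2))
  ultimately show ?thesis by (metis has_sum_infsum)
qed

section \<open>Value of the simple sum and the elliptic Cauchy determinant\<close>

context qbase
begin

text \<open>For nonzero \<open>z\<close> this is
  \<open>asym z * qpair (1 / z) z * qpair z z\<close>: the single surviving term in
  \<open>ksum_eq\<close> without its denominator.\<close>

definition kappa :: "complex \<Rightarrow> complex" where
  "kappa z = asym z * (qpoch_inf q q ^ 2 * (qpoch_inf q (q * z ^ 2) * qpoch_inf q (q / z ^ 2)))"

lemma thdiff_nonzeroD':
  assumes "thdiff z a \<noteq> 0" "z \<noteq> 0" "a \<noteq> 0"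
  shows "symp (z * q powi y) \<noteq> symp a"
  using thdiff_nonzeroD[of a z y] thdiff_antisym[of a z] assms by simp

text \<open>
  With $b = 1/z$ and $d = z$ in \<open>has_sum_kernel_qpair\<close>, the two products vanish at
  $x = z q^y$ unless $y = 0$.
\<close>

lemma ksum_eq:
  assumes "z \<noteq> 0" "a \<noteq> 0" "thdiff z a \<noteq> 0"
  shows "ksum z a = kappa z / thdiff z a"
proof -
  note off = thdiff_nonzeroD'[OF assms(3,1,2)]
  define f where "f y = kernel a (z * q powi y) * (linprod [] (z * q powi y) * qpair (1 / z) (z * q powi y) * qpair z (z * q powi y))
       * gauss z y" for y
  have "(f has_sum (linprod [] a * qpair (1 / z) a * qpair z a * ksum z a)) UNIV"
    unfolding f_def
    by (rule has_sum_kernel_qpair[OF assms(1,2) off]) (use q_lt assms in \<open>simp add: norm_divide\<close>)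
  moreover have "(f has_sum f 0) UNIV"
  proof (rule has_sum_finite_neutralI[of "{0}"])
    fix y :: int assume "y \<in> UNIV - {0}"
    then consider i where "y = - int (Suc i)" | i where "y = int (Suc i)"
      by (cases y rule: int_cases3) (auto simp: gr0_conv_Suc)
    then show "f y = 0"
    proof cases
      case (1 i)
      have "q * (1 / z) * (z * q powi y) * q ^ i = 1"
        using q_nz assms unfolding 1 by (simp only: power_int_minus power_int_of_nat) (simp add: field_simps)
      then have "qpair (1 / z) (z * q powi y) = 0"
        unfolding qpair_def using qpoch_inf_eq_0_iff by auto
      then show ?thesis by (simp add: f_def)
    next
      case (2 i)
      have "q * z / (z * q powi y) * q ^ i = 1"
        using q_nz assms unfolding 2 by (simp only: power_int_of_nat) simp
      then have "qpair z (z * q powi y) = 0"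
        unfolding qpair_def using qpoch_inf_eq_0_iff by auto
      then show ?thesis by (simp add: f_def)
    qed
  qed auto
  ultimately have "qpair (1 / z) a * qpair z a * ksum z a = f 0"
    using has_sum_unique by (fastforce simp: linprod_def)
  moreover have "f 0 = kappa z / (symp z - symp a)"
    using assms by (simp add: f_def linprod_def kernel_def kappa_def qpair_def power2_eq_square mult_ac)
  moreover have "thdiff z a = (symp z - symp a) * (qpair (1 / z) a * qpair z a)"
    by (simp add: thdiff_def theta4_def mult_ac)
  ultimately show ?thesis
    using assms(3) by (simp add: eq_divide_eq mult_ac)
qed

corollary has_sum_kernel:
  assumes "z \<noteq> 0" "a \<noteq> 0" "thdiff z a \<noteq> 0"
    and "norm q * (1 / norm q) ^ length gs * (norm b * norm d) < 1"
  shows "((\<lambda>y. kernel a (z * q powi y) * (linprod gs (z * q powi y) * qpair b (z * q powi y) * qpair d (z * q powi y))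
       * gauss z y) has_sum (linprod gs a * qpair b a * qpair d a * (kappa z / thdiff z a))) UNIV"
  using has_sum_kernel_qpair[OF assms(1,2) thdiff_nonzeroD'[OF assms(3,1,2)] assms(4)] ksum_eq[OF assms(1-3)]
  by simp

text \<open>The simple sum with parameters u and 1/u, where the infinite products form
  \<open>theta4 u\<close>. By \<open>thdiff_gauss\<close>, \<open>theta4 u x\<close> times the
  weight is a constant over \<open>symp u - symp x\<close>: the Gaussian disappears and a partial
  fraction remains.\<close>

lemma has_sum_thdiff_quotient:
  assumes nz: "w \<noteq> 0" "u \<noteq> 0" "a \<noteq> 0" and th: "thdiff w u \<noteq> 0" "thdiff w a \<noteq> 0"
  shows "((\<lambda>y. asym (w * q powi y) * (1 / (symp (w * q powi y) - symp a) - 1 / (symp (w * q powi y) - symp u)))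
    has_sum (kappa w * (thdiff u a / (thdiff u w * thdiff w a)))) UNIV"
proof -
  have th': "thdiff u w \<noteq> 0" using th thdiff_antisym[of u w] by simp
  \<comment> \<open>The numerator is that of the partial fraction decomposition; the denominator
    removes the constant of \<open>thdiff_gauss\<close>.\<close>
  define c where "c = (symp u - symp a) / thdiff u w"
  have "((\<lambda>y. c * (kernel a (w * q powi y) * (linprod [] (w * q powi y) * qpair u (w * q powi y) * qpair (1 / u) (w * q powi y))
       * gauss w y)) has_sum (c * (linprod [] a * qpair u a * qpair (1 / u) a * (kappa w / thdiff w a)))) UNIV"
    by (intro has_sum_cmult_right has_sum_kernel) (use nz th q_lt in \<open>auto simp: norm_divide\<close>)
  moreover have "c * (kernel a (w * q powi y) * (linprod [] (w * q powi y) * qpair u (w * q powi y) * qpair (1 / u) (w * q powi y)) * gauss w y)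
    = asym (w * q powi y) * (1 / (symp (w * q powi y) - symp a) - 1 / (symp (w * q powi y) - symp u))" for y
  proof -
    define x where "x = w * q powi y"
    have s: "symp x - symp a \<noteq> 0" "symp u - symp x \<noteq> 0" "symp x - symp u \<noteq> 0"
      using thdiff_nonzeroD'[OF th(2) nz(1,3), of y] thdiff_nonzeroD'[OF th(1) nz(1,2), of y] by (auto simp: x_def)
    have "(symp u - symp x) * (qpair u x * qpair (1 / u) x * gauss w y) = thdiff u w"
      using thdiff_gauss[OF nz(2,1), of y] by (simp add: x_def thdiff_def theta4_def mult_ac)
    then have "qpair u x * qpair (1 / u) x * gauss w y = thdiff u w / (symp u - symp x)"
      using s(2) by (metis nonzero_mult_div_cancel_left)
    then have "c * (kernel a x * (linprod [] x * qpair u x * qpair (1 / u) x) * gauss w y)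
        = c * kernel a x * (thdiff u w / (symp u - symp x))"
      by (simp add: linprod_def mult.assoc)
    also have "\<dots> = asym x * ((symp u - symp a) / ((symp x - symp a) * (symp u - symp x)))"
      using th' by (simp add: c_def kernel_def)
    also have "(symp u - symp a) / ((symp x - symp a) * (symp u - symp x)) = 1 / (symp x - symp a) - 1 / (symp x - symp u)"
      using s by (simp add: divide_simps) (simp add: algebra_simps)
    finally show ?thesis by (simp add: x_def)
  qed
  moreover have "c * (linprod [] a * qpair u a * qpair (1 / u) a * (kappa w / thdiff w a)) = kappa w * (thdiff u a / (thdiff u w * thdiff w a))"
    by (simp add: c_def linprod_def thdiff_def[of u a] theta4_def)
  ultimately show ?thesis by simp
qed

text \<open>
  The summand of \<open>has_sum_thdiff_quotient\<close> is a difference of a term in \<open>a\<close> and one in \<open>u\<close>, so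
  its value is one as well. This replaces the three-term (Weierstrass) relation for theta functions.
\<close>

lemma thdiff_rank_two_pivot:
  assumes "w \<noteq> 0" "kappa w \<noteq> 0" and S: "\<And>u. u \<in> S \<Longrightarrow> u \<noteq> 0 \<and> thdiff w u \<noteq> 0"
  shows "\<exists>R. \<forall>u\<in>S. \<forall>v\<in>S. thdiff u v = thdiff w u * thdiff w v * (R u - R v)"
proof (cases "S = {}")
  case False
  \<comment> \<open>A base point is needed because the two halves cannot be summed separately: asym
    x / (symp x - symp a) tends to 1 and -1 at the two ends of the orbit.\<close>
  then obtain o' where o': "o' \<in> S" by blast
  define r where "r u a = thdiff u a / (thdiff u w * thdiff w a)" for u a
  have 1: "r u v = r o' v - r o' u" if uv: "u \<in> S" "v \<in> S" for u v
  proof -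
    have "((\<lambda>y. asym (w * q powi y) * (1 / (symp (w * q powi y) - symp v) - 1 / (symp (w * q powi y) - symp o'))
       - asym (w * q powi y) * (1 / (symp (w * q powi y) - symp u) - 1 / (symp (w * q powi y) - symp o')))
       has_sum (kappa w * r o' v - kappa w * r o' u)) UNIV"
      unfolding r_def by (intro has_sum_diff has_sum_thdiff_quotient) (use assms o' uv in auto)
    moreover have "((\<lambda>y. asym (w * q powi y) * (1 / (symp (w * q powi y) - symp v) - 1 / (symp (w * q powi y) - symp u)))
        has_sum (kappa w * r u v)) UNIV"
      unfolding r_def by (intro has_sum_thdiff_quotient) (use assms o' uv in auto)
    ultimately have "kappa w * r o' v - kappa w * r o' u = kappa w * r u v"
      by (intro has_sum_unique[where A = UNIV and f = "\<lambda>y. asym (w * q powi y) * (1 / (symp (w * q powi y) - symp v) - 1 / (symp (w * q powi y) - symp u))"])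
         (simp_all add: right_diff_distrib)
    then show ?thesis
      using assms(2) by (metis mult_left_cancel right_diff_distrib)
  qed
  have 2: "thdiff u v = - (thdiff w u * thdiff w v * r u v)" if "u \<in> S" "v \<in> S" for u v
    using S[OF that(1)] S[OF that(2)] thdiff_antisym[of u w] by (simp add: r_def)
  have "thdiff u v = thdiff w u * thdiff w v * (r o' u - r o' v)" if "u \<in> S" "v \<in> S" for u v
    unfolding 2[OF that] 1[OF that] by (simp add: right_diff_distrib)
  then show ?thesis by blast
qed auto

text \<open>The pivot \<open>w\<close> has to avoid 0, the zeros of \<open>kappa\<close> (where w^2
  is a power of q) and those of \<open>thdiff w u\<close> for the finitely many \<open>u\<close>,
  altogether countably many points. Then \<open>thdiff w\<close> serves as \<open>h\<close>.\<close>

lemma thdiff_rank_two: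
  assumes "finite S" "0 \<notin> S"
  shows "\<exists>h R. (\<forall>u\<in>S. h u \<noteq> 0) \<and> (\<forall>u\<in>S. \<forall>v\<in>S. thdiff u v = h u * h v * (R u - R v))"
proof -
  define bad where "bad = {0} \<union> (\<Union>y::int. {csqrt (q powi y), - csqrt (q powi y)})
    \<union> (\<Union>u\<in>S. \<Union>y::int. {u * q powi y, q powi y / u})"
  have "countable bad"
    unfolding bad_def
    by (intro countable_Un countable_UN countableI_type countable_finite[OF assms(1)]) simp_all
  then have "bad \<noteq> UNIV"
    using uncountable_UNIV_complex by auto
  then obtain w where w: "w \<notin> bad" by blast
  then have w0: "w \<noteq> 0" by (auto simp: bad_def)
  have sq: "w ^ 2 \<noteq> q powi y" for y
  proof
    assume "w ^ 2 = q powi y"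
    then have "w ^ 2 = csqrt (q powi y) ^ 2" by simp
    then have "w = csqrt (q powi y) \<or> w = - csqrt (q powi y)" by (simp only: power2_eq_iff)
    then show False using w by (auto simp: bad_def)
  qed
  have "kappa w \<noteq> 0"
  proof -
    have "q * q ^ i \<noteq> 1" for i
      using q_lt power_Suc_less_one[of "norm q" i] by (metis norm_ge_zero norm_one norm_power order_less_irrefl power_Suc power_less_one_iff zero_less_Suc)
    moreover have "q * w ^ 2 * q ^ i \<noteq> 1" for i
    proof
      assume "q * w ^ 2 * q ^ i = 1"
      then have "w ^ 2 = q powi (- int (Suc i))"
        using q_nz by (simp only: power_int_minus power_int_of_nat) (simp add: field_simps)
      then show False using sq by simp
    qed
    moreover have "q / w ^ 2 * q ^ i \<noteq> 1" for i
    proof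
      assume "q / w ^ 2 * q ^ i = 1"
      then have "w ^ 2 = q powi (int (Suc i))"
        using w0 by (simp only: power_int_of_nat) (simp add: field_simps)
      then show False using sq by simp
    qed
    moreover have "asym w \<noteq> 0"
      using sq[of 0] w0 by (simp add: asym_def field_simps power2_eq_square)
    ultimately show ?thesis using w0 by (auto simp: kappa_def qpoch_inf_eq_0_iff)
  qed
  moreover have th: "u \<noteq> 0 \<and> thdiff w u \<noteq> 0" if u: "u \<in> S" for u
  proof
    show u0: "u \<noteq> 0" using assms u by auto
    show "thdiff w u \<noteq> 0"
    proof
      assume "thdiff w u = 0"
      then have "thdiff u w = 0" using thdiff_antisym[of u w] by simp
      then obtain y where "w = u * q powi y \<or> w * u = q powi y"
        using thdiff_eq_0D u0 w0 by blast
      then have "w = u * q powi y \<or> w = q powi y / u" using u0 by (auto simp: field_simps)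
      then show False using w u by (auto simp: bad_def)
    qed
  qed
  ultimately obtain R where "\<forall>u\<in>S. \<forall>v\<in>S. thdiff u v = thdiff w u * thdiff w v * (R u - R v)"
    using thdiff_rank_two_pivot[OF w0, of S] by blast
  then show ?thesis using th by blast
qed

text \<open>
  Normalised so that neither the Vandermonde product in \<open>symp (a j)\<close> nor \<open>W n z\<close> occurs in a
  denominator.
\<close>

definition mterm :: "nat \<Rightarrow> (complex \<Rightarrow> complex) \<Rightarrow> (nat \<Rightarrow> complex) \<Rightarrow> (nat \<Rightarrow> complex) \<Rightarrow> (nat \<Rightarrow> int) \<Rightarrow> complex" where
  "mterm n Q a z y = (\<Prod>k=1..n. asym (z k * q powi y k) * Q (z k * q powi y k) * gauss (z k) (y k)) *
     ((\<Prod>k=1..n. \<Prod>j=1..<k. symp (z k * q powi y k) - symp (z j * q powi y j)) /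
      (\<Prod>k=1..n. \<Prod>j=1..n. symp (z k * q powi y k) - symp (a j)))"

definition mvalue :: "nat \<Rightarrow> (complex \<Rightarrow> complex) \<Rightarrow> (nat \<Rightarrow> complex) \<Rightarrow> (nat \<Rightarrow> complex) \<Rightarrow> complex" where
  "mvalue n Q a z = (\<Prod>k=1..n. Q (a k) * kappa (z k)) *
     ((\<Prod>k=1..n. \<Prod>j=1..<k. thdiff (z k) (z j) * theta4 (a j) (a k)) /
      (\<Prod>k=1..n. \<Prod>j=1..n. thdiff (z k) (a j)))"

text \<open>After \<open>h\<close> is divided out, the entries are 1/(R(z) - R(a)). Putting all z
  and a into one set gives a single \<open>R\<close> for the entries and for the differences within
  z and within a.\<close>

lemma elliptic_cauchy_expansion:
  assumes z: "\<And>k. k \<in> {1..n} \<Longrightarrow> z k \<noteq> 0" and a: "\<And>k. k \<in> {1..n} \<Longrightarrow> a k \<noteq> 0"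
    and th: "\<And>j k. j \<in> {1..n} \<Longrightarrow> k \<in> {1..n} \<Longrightarrow> thdiff (z k) (a j) \<noteq> 0"
  shows "(\<Sum>p | p permutes {0..<n}. signof p * (\<Prod>k=1..n. 1 / thdiff (z k) (a (Suc (p (k - 1))))))
    = (\<Prod>k=1..n. \<Prod>j=1..<k. thdiff (z k) (z j) * thdiff (a j) (a k)) / (\<Prod>k=1..n. \<Prod>j=1..n. thdiff (z k) (a j))"
proof -
  have S: "finite (z ` {1..n} \<union> a ` {1..n})" "0 \<notin> z ` {1..n} \<union> a ` {1..n}"
    using z a by force+
  obtain h R where hR: "\<forall>u\<in>z ` {1..n} \<union> a ` {1..n}. h u \<noteq> 0"
      "\<forall>u\<in>z ` {1..n} \<union> a ` {1..n}. \<forall>v\<in>z ` {1..n} \<union> a ` {1..n}. thdiff u v = h u * h v * (R u - R v)"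
    using thdiff_rank_two[OF S] by metis
  note h = bspec[OF hR(1)] and R = bspec[OF bspec[OF hR(2)]]
  have hz: "h (z k) \<noteq> 0" and ha: "h (a k) \<noteq> 0" if "k \<in> {1..n}" for k
    using h that by auto
  have sig: "Suc (p (k - 1)) \<in> {1..n}" if "p permutes {0..<n}" "k \<in> {1..n}" for p k
    using permutes_in_image[OF that(1), of "k - 1"] that(2) by auto
  have perm: "(\<Prod>k=1..n. f (Suc (p (k - 1)))) = (\<Prod>k=1..n. f k)" if p: "p permutes {0..<n}" for p and f :: "nat \<Rightarrow> complex"
    using prod.permute[OF p, of "f \<circ> Suc"] by (simp add: prod.atLeast1_atMost_eq o_def atLeast0LessThan)
  have Rne: "R (z k) \<noteq> R (a j)" if "k \<in> {1..n}" "j \<in> {1..n}" for k j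
    using th[OF that(2,1)] R[of "z k" "a j"] that by auto
  define H where "H = (\<Prod>k=1..n. h (z k) * h (a k))"
  have H: "H \<noteq> 0" using hz ha by (simp add: H_def)
  have "(\<Prod>k=1..n. 1 / thdiff (z k) (a (Suc (p (k - 1)))))
      = (1 / H) * (\<Prod>k=1..n. 1 / (R (z k) - R (a (Suc (p (k - 1))))))" if p: "p permutes {0..<n}" for p
  proof -
    have "(\<Prod>k=1..n. 1 / thdiff (z k) (a (Suc (p (k - 1)))))
      = (\<Prod>k=1..n. (1 / h (z k)) * (1 / h (a (Suc (p (k - 1))))) * (1 / (R (z k) - R (a (Suc (p (k - 1)))))))"
      using sig[OF p] by (intro prod.cong refl) (subst R, auto)
    also have "\<dots> = (\<Prod>k=1..n. 1 / h (z k)) * (\<Prod>k=1..n. 1 / h (a k)) * (\<Prod>k=1..n. 1 / (R (z k) - R (a (Suc (p (k - 1))))))"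
      by (simp only: prod.distrib perm[OF p, of "\<lambda>k. 1 / h (a k)"])
    finally show ?thesis by (simp add: H_def prod.distrib prod_dividef)
  qed
  then have "(\<Sum>p | p permutes {0..<n}. signof p * (\<Prod>k=1..n. 1 / thdiff (z k) (a (Suc (p (k - 1))))))
      = (1 / H) * (\<Sum>p | p permutes {0..<n}. signof p * (\<Prod>k=1..n. 1 / (R (z k) - R (a (Suc (p (k - 1)))))))"
    unfolding sum_distrib_left by (intro sum.cong refl) simp
  also have "(\<Sum>p | p permutes {0..<n}. signof p * (\<Prod>k=1..n. 1 / (R (z k) - R (a (Suc (p (k - 1)))))))
      = (\<Prod>k=1..n. \<Prod>j=1..<k. (R (z k) - R (z j)) * (R (a j) - R (a k))) / (\<Prod>k=1..n. \<Prod>j=1..n. R (z k) - R (a j))"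
    by (rule cauchy_expansion) (rule Rne)
  finally have L: "(\<Sum>p | p permutes {0..<n}. signof p * (\<Prod>k=1..n. 1 / thdiff (z k) (a (Suc (p (k - 1))))))
      = (1 / H) * ((\<Prod>k=1..n. \<Prod>j=1..<k. (R (z k) - R (z j)) * (R (a j) - R (a k))) / (\<Prod>k=1..n. \<Prod>j=1..n. R (z k) - R (a j)))" .
  \<comment> \<open>Balance of the powers of \<open>h\<close>: the off-diagonal pairs match the
    numerator of the claim, and the diagonal matches the \<open>1 / H\<close> common to all
    permutations.\<close>
  have h_pairs: "(\<Prod>k=1..n. \<Prod>j=1..n. h (z k) * h (a j)) = (\<Prod>k=1..n. \<Prod>j=1..<k. h (z k) * h (z j) * (h (a j) * h (a k))) * (\<Prod>k=1..n. h (z k) * h (a k))"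
    using prod_square[of "\<lambda>k j. h (z k) * h (a j)" n] by (simp add: mult_ac)
  have 1: "(\<Prod>k=1..n. \<Prod>j=1..<k. thdiff (z k) (z j) * thdiff (a j) (a k))
    = (\<Prod>k=1..n. \<Prod>j=1..<k. h (z k) * h (z j) * (h (a j) * h (a k))) * (\<Prod>k=1..n. \<Prod>j=1..<k. (R (z k) - R (z j)) * (R (a j) - R (a k)))"
    unfolding prod.distrib[symmetric] by (intro prod.cong refl, subst (1 2) R) auto
  have 2: "(\<Prod>k=1..n. \<Prod>j=1..n. thdiff (z k) (a j))
    = (\<Prod>k=1..n. \<Prod>j=1..<k. h (z k) * h (z j) * (h (a j) * h (a k))) * H * (\<Prod>k=1..n. \<Prod>j=1..n. R (z k) - R (a j))"
  proof -
    have "(\<Prod>k=1..n. \<Prod>j=1..n. thdiff (z k) (a j)) = (\<Prod>k=1..n. \<Prod>j=1..n. h (z k) * h (a j) * (R (z k) - R (a j)))"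
      by (intro prod.cong refl R) auto
    also have "\<dots> = (\<Prod>k=1..n. \<Prod>j=1..n. h (z k) * h (a j)) * (\<Prod>k=1..n. \<Prod>j=1..n. R (z k) - R (a j))"
      by (simp only: prod.distrib)
    finally show ?thesis unfolding H_def h_pairs .
  qed
  have "(\<Prod>k=1..n. \<Prod>j=1..<k. h (z k) * h (z j) * (h (a j) * h (a k))) \<noteq> 0"
    using hz ha by auto
  then show ?thesis unfolding L 1 2 using H by simp
qed

text \<open>Each permutation contributes a product of simple sums. Its factor from \<open>Q\<close>
  is the same for all permutations, so the values reassemble to an elliptic Cauchy determinant;
  distinctness permits division by \<open>V\<close>.\<close>

lemma has_sum_mterm_generic:
  assumes z: "\<And>k. k \<in> {1..n} \<Longrightarrow> z k \<noteq> 0" and a: "\<And>k. k \<in> {1..n} \<Longrightarrow> a k \<noteq> 0"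
    and th: "\<And>j k. j \<in> {1..n} \<Longrightarrow> k \<in> {1..n} \<Longrightarrow> thdiff (z k) (a j) \<noteq> 0"
    and distinct: "\<And>j k. k \<in> {1..n} \<Longrightarrow> j \<in> {1..<k} \<Longrightarrow> symp (a j) \<noteq> symp (a k)"
    and conv: "norm q * (1 / norm q) ^ length gs * (norm b * norm d) < 1"
    and Q: "Q = (\<lambda>x. linprod gs x * qpair b x * qpair d x)"
  shows "((\<lambda>y. mterm n Q a z y) has_sum mvalue n Q a z) (int_tuples n)"
proof -
  define P where "P = {p. p permutes {0..<n}}"
  define \<sigma> where "\<sigma> p k = Suc (p (k - 1))" for p :: "nat \<Rightarrow> nat" and k
  define V where "V = (\<Prod>k=1..n. \<Prod>j=1..<k. symp (a j) - symp (a k))"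
  have V: "V \<noteq> 0" using distinct by (simp add: V_def)
  have sig: "\<sigma> p k \<in> {1..n}" if "p \<in> P" "k \<in> {1..n}" for p k
  proof -
    have "p (k - 1) \<in> {0..<n}"
      by (rule permutes_in_image[THEN iffD2]) (use that in \<open>auto simp: P_def\<close>)
    then show ?thesis by (simp add: \<sigma>_def)
  qed
  have perm: "(\<Prod>k=1..n. f (\<sigma> p k)) = (\<Prod>k=1..n. f k)" if "p \<in> P" for p and f :: "nat \<Rightarrow> complex"
    using prod.permute[of p "{0..<n}" "f \<circ> Suc"] that
    by (simp add: P_def \<sigma>_def prod.atLeast1_atMost_eq o_def atLeast0LessThan)
  define x where "x y k = z k * q powi y k" for y :: "nat \<Rightarrow> int" and k
  have "((\<lambda>y. \<Prod>k\<in>{1..n}. kernel (a (\<sigma> p k)) (x y k) * Q (x y k) * gauss (z k) (y k))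
      has_sum (\<Prod>k\<in>{1..n}. Q (a (\<sigma> p k)) * (kappa (z k) / thdiff (z k) (a (\<sigma> p k))))) (PiE {1..n} (\<lambda>_. UNIV))" if p: "p \<in> P" for p
    unfolding x_def Q
  proof (rule has_sum_prod_PiE[where f = "\<lambda>k y. kernel (a (\<sigma> p k)) (z k * q powi y) *
        (linprod gs (z k * q powi y) * qpair b (z k * q powi y) * qpair d (z k * q powi y)) * gauss (z k) y"])
    fix k assume k: "k \<in> {1..n}"
    show "((\<lambda>y. kernel (a (\<sigma> p k)) (z k * q powi y) *
        (linprod gs (z k * q powi y) * qpair b (z k * q powi y) * qpair d (z k * q powi y)) * gauss (z k) y)
        has_sum (linprod gs (a (\<sigma> p k)) * qpair b (a (\<sigma> p k)) * qpair d (a (\<sigma> p k)) *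
          (kappa (z k) / thdiff (z k) (a (\<sigma> p k))))) UNIV"
      by (rule has_sum_kernel[OF z[OF k] a[OF sig[OF p k]] th[OF sig[OF p k] k] conv])
  qed simp
  then have "((\<lambda>y. (1 / V) * (\<Sum>p\<in>P. signof p * (\<Prod>k\<in>{1..n}. kernel (a (\<sigma> p k)) (x y k) * Q (x y k) * gauss (z k) (y k))))
      has_sum (1 / V) * (\<Sum>p\<in>P. signof p * (\<Prod>k\<in>{1..n}. Q (a (\<sigma> p k)) * (kappa (z k) / thdiff (z k) (a (\<sigma> p k)))))) (int_tuples n)"
    unfolding int_tuples_def
    by (intro has_sum_cmult_right has_sum_sum_complex) (auto simp: P_def finite_permutations)
  moreover have "(1 / V) * (\<Sum>p\<in>P. signof p * (\<Prod>k\<in>{1..n}. kernel (a (\<sigma> p k)) (x y k) * Q (x y k) * gauss (z k) (y k))) = mterm n Q a z y" for y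
  proof -
    have "(\<Sum>p\<in>P. signof p * (\<Prod>k\<in>{1..n}. kernel (a (\<sigma> p k)) (x y k) * Q (x y k) * gauss (z k) (y k)))
       = (\<Prod>k=1..n. asym (x y k) * Q (x y k) * gauss (z k) (y k)) * (\<Sum>p\<in>P. signof p * (\<Prod>k=1..n. 1 / (symp (x y k) - symp (a (\<sigma> p k)))))"
      unfolding sum_distrib_left by (intro sum.cong refl) (simp add: kernel_def prod.distrib prod_dividef)
    also have "(\<Sum>p\<in>P. signof p * (\<Prod>k=1..n. 1 / (symp (x y k) - symp (a (\<sigma> p k)))))
      = (\<Prod>k=1..n. \<Prod>j=1..<k. (symp (x y k) - symp (x y j)) * (symp (a j) - symp (a k))) / (\<Prod>k=1..n. \<Prod>j=1..n. symp (x y k) - symp (a j))"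
      unfolding P_def \<sigma>_def
      by (rule cauchy_expansion[where X = "\<lambda>k. symp (x y k)" and \<alpha> = "\<lambda>j. symp (a j)"])
         (use thdiff_nonzeroD' th z a in \<open>auto simp: x_def\<close>)
    finally show ?thesis
      using V by (simp add: mterm_def x_def V_def prod.distrib)
  qed
  moreover have "(1 / V) * (\<Sum>p\<in>P. signof p * (\<Prod>k\<in>{1..n}. Q (a (\<sigma> p k)) * (kappa (z k) / thdiff (z k) (a (\<sigma> p k))))) = mvalue n Q a z"
  proof -
    have "(\<Prod>k\<in>{1..n}. Q (a (\<sigma> p k)) * (kappa (z k) / thdiff (z k) (a (\<sigma> p k)))) =
      (\<Prod>k=1..n. Q (a k) * kappa (z k)) * (\<Prod>k=1..n. 1 / thdiff (z k) (a (\<sigma> p k)))" if "p \<in> P" for p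
      using perm[OF that, of "\<lambda>k. Q (a k)"] by (simp add: prod.distrib prod_dividef)
    then have "(\<Sum>p\<in>P. signof p * (\<Prod>k\<in>{1..n}. Q (a (\<sigma> p k)) * (kappa (z k) / thdiff (z k) (a (\<sigma> p k)))))
       = (\<Prod>k=1..n. Q (a k) * kappa (z k)) * (\<Sum>p\<in>P. signof p * (\<Prod>k=1..n. 1 / thdiff (z k) (a (\<sigma> p k))))"
      unfolding sum_distrib_left by (intro sum.cong refl) simp
    also have "(\<Sum>p\<in>P. signof p * (\<Prod>k=1..n. 1 / thdiff (z k) (a (\<sigma> p k))))
      = (\<Prod>k=1..n. \<Prod>j=1..<k. thdiff (z k) (z j) * thdiff (a j) (a k)) / (\<Prod>k=1..n. \<Prod>j=1..n. thdiff (z k) (a j))"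
      unfolding P_def \<sigma>_def by (rule elliptic_cauchy_expansion) (use z a th in auto)
    also have "(\<Prod>k=1..n. \<Prod>j=1..<k. thdiff (z k) (z j) * thdiff (a j) (a k))
      = V * (\<Prod>k=1..n. \<Prod>j=1..<k. thdiff (z k) (z j) * theta4 (a j) (a k))"
      unfolding V_def prod.distrib[symmetric] by (intro prod.cong refl) (simp add: thdiff_def[of "a _"])
    finally show ?thesis using V by (simp add: mvalue_def)
  qed
  ultimately show ?thesis by simp
qed

end

section \<open>Integer-indexed shifted factorials\<close>

lemma qpoch_rec:
  assumes "qpoch_defined q a y" "q \<noteq> 0"
  shows "qpoch q a (y + 1) = qpoch q a y * (1 - a * q powi y)"
proof (cases "y \<ge> 0")
  case True
  then have "nat (y + 1) = Suc (nat y)" by simp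
  then show ?thesis using True by (simp add: qpoch_def power_int_def)
next
  case False
  define n where "n = nat (- (y + 1))"
  have y: "y = - int (Suc n)" using False by (simp add: n_def)
  have "1 - a * q powi (- int (Suc n)) \<noteq> 0"
    using assms(1) unfolding qpoch_defined_def y by (auto dest!: bspec[of _ _ "Suc n"])
  moreover have "qpoch q a y = 1 / ((\<Prod>i=1..n. 1 - a * q powi (- int i)) * (1 - a * q powi (- int (Suc n))))"
    unfolding qpoch_def y by (simp del: of_nat_Suc)
  moreover have "qpoch q a (y + 1) = 1 / (\<Prod>i=1..n. 1 - a * q powi (- int i))"
  proof -
    have "y + 1 = - int n" using y by simp
    \<comment> \<open>For n = 0 the index y + 1 is 0 and falls under the nonnegative branch of
      \<open>qpoch\<close>.\<close>
    then show ?thesis by (cases n) (simp_all del: of_nat_Suc add: qpoch_def)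
  qed
  ultimately show ?thesis unfolding y by (simp del: of_nat_Suc)
qed

lemma qpoch_0 [simp]: "qpoch q a 0 = 1"
  by (simp add: qpoch_def)

lemma qpoch_definedD:
  assumes "qpoch_defined q a y" "y < 0"
  shows "1 - a * q powi y \<noteq> 0"
proof -
  have "nat (- y) \<in> {1..nat (- y)}" using assms(2) by simp
  then have "1 - a * q powi (- int (nat (- y))) \<noteq> 0"
    using assms unfolding qpoch_defined_def by blast
  then show ?thesis using assms(2) by simp
qed

lemma qpoch_nonzeroD:
  assumes "qpoch_defined q a y" "q \<noteq> 0" "qpoch q a (y + 1) \<noteq> 0"
  shows "1 - a * q powi y \<noteq> 0"
  using qpoch_rec[OF assms(1,2)] assms(3) by auto

section \<open>Factors of the summand as functions of the shifted variable\<close>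

context qbase
begin

text \<open>Both sides obey the same first-order recurrence. The Gaussian arises from 1 - 1/(c x) =
  -(1 - c x)/(c x), used for c = b and c = d: the resulting 1/(b d x^2) meets the factor q x^2 of
  \<open>gauss_rec\<close>.\<close>

lemma bilateral_bd:
  assumes nz: "b \<noteq> 0" "d \<noteq> 0" "z \<noteq> 0"
    and num: "\<And>y. qpoch_defined q (b * z) y" "\<And>y. qpoch_defined q (d * z) y"
    and den: "\<And>y. qpoch_defined q (q * z / b) y" "\<And>y. qpoch_defined q (q * z / d) y"
      "\<And>y. qpoch q (q * z / b) y \<noteq> 0" "\<And>y. qpoch q (q * z / d) y \<noteq> 0"
    and pz: "qpair (1 / b) z \<noteq> 0" "qpair (1 / d) z \<noteq> 0"
  shows "qpoch q (b * z) y * qpoch q (d * z) y / (qpoch q (q * z / b) y * qpoch q (q * z / d) y) * (q / (b * d)) powi y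
    = gauss z y * (qpair (1 / b) (z * q powi y) * qpair (1 / d) (z * q powi y)) / (qpair (1 / b) z * qpair (1 / d) z)"
    (is "?f y = ?g y")
proof (rule int_recurrence_unique[where f = ?f and g = ?g])
  define \<rho> where "\<rho> y = (1 - b * z * q powi y) * (1 - d * z * q powi y) /
    ((1 - q * z / b * q powi y) * (1 - q * z / d * q powi y)) * (q / (b * d))" for y
  show "?f 0 = ?g 0" using pz by simp
  show "\<rho> y \<noteq> 0" if "y < 0" for y
    using qpoch_definedD[OF num(1) that] qpoch_definedD[OF num(2) that] q_nz nz
      qpoch_nonzeroD[OF den(1) q_nz den(3)] qpoch_nonzeroD[OF den(2) q_nz den(4)]
    by (simp add: \<rho>_def)
  show "?f (y + 1) = \<rho> y * ?f y" for y
    unfolding qpoch_rec[OF num(1) q_nz] qpoch_rec[OF num(2) q_nz] qpoch_rec[OF den(1) q_nz] qpoch_rec[OF den(2) q_nz]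
    using q_nz nz by (simp add: \<rho>_def power_int_add mult_ac)
  show "?g (y + 1) = \<rho> y * ?g y" for y
  proof -
    define x where "x = z * q powi y"
    have x: "x \<noteq> 0" using nz q_nz by (simp add: x_def)
    have e: "z * q powi (y + 1) = q * x" using q_nz by (simp add: x_def power_int_add)
    have step: "qpair (1 / c) (q * x) = (1 - c * x) / (1 - q * x / c) * (- 1 / (c * x)) * qpair (1 / c) x"
      if c: "c \<noteq> 0" "1 - q * x / c \<noteq> 0" for c
    proof -
      have "qpair (1 / c) (q * x) = qpair (1 / c) (q * x) * (1 - q * x / c) / (1 - q * x / c)"
        using c(2) by (simp only: nonzero_mult_div_cancel_right not_False_eq_True)
      also have "qpair (1 / c) (q * x) * (1 - q * x / c) = (1 - 1 / (c * x)) * qpair (1 / c) x"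
        using qpair_rec[OF x, of "1 / c"] by simp
      also have "1 - 1 / (c * x) = (1 - c * x) * (- 1 / (c * x))"
        using c x by (simp add: field_simps)
      finally show ?thesis by (simp only: times_divide_eq_left times_divide_eq_right mult_ac)
    qed
    have nb: "1 - q * x / b \<noteq> 0" "1 - q * x / d \<noteq> 0"
      using qpoch_nonzeroD[OF den(1) q_nz den(3), of y] qpoch_nonzeroD[OF den(2) q_nz den(4), of y]
      by (simp_all add: x_def mult_ac)
    have r: "\<rho> y = (1 - b * x) * (1 - d * x) / ((1 - q * x / b) * (1 - q * x / d)) * (q / (b * d))"
      by (simp add: \<rho>_def x_def mult_ac)
    have "x ^ 2 * q * ((- 1 / (b * x)) * (- 1 / (d * x))) = q / (b * d)"
      using x nz by (simp add: power2_eq_square)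
    then show ?thesis
      unfolding e gauss_rec[OF nz(3)] x_def[symmetric] r step[OF nz(1) nb(1)] step[OF nz(2) nb(2)]
      by (simp add: x power2_eq_square mult_ac)
  qed
qed

lemma linprod_linlist_rec:
  assumes "x \<noteq> 0"
  shows "linprod (linlist c m) (q * x) * ((1 - c * x) * (1 - c / x * q ^ m / q))
    = (1 - c * x * q ^ m) * (1 - c / (q * x)) * linprod (linlist c m) x"
proof -
  have *: "(1 - a) * (\<Prod>i<m. 1 - (q * a) * q ^ i) = (\<Prod>i<m. 1 - a * q ^ i) * (1 - a * q ^ m)" for a
  proof -
    have "(\<Prod>i<Suc m. 1 - a * q ^ i) = (1 - a) * (\<Prod>i<m. 1 - (q * a) * q ^ i)"
      by (subst prod.lessThan_Suc_shift) (simp add: mult_ac)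
    then show ?thesis by simp
  qed
  have 1: "(1 - c * x) * (\<Prod>i<m. 1 - c * (q * x) * q ^ i) = (\<Prod>i<m. 1 - c * x * q ^ i) * (1 - c * x * q ^ m)"
    using *[of "c * x"] by (simp add: mult_ac)
  have 2: "(1 - c / (q * x)) * (\<Prod>i<m. 1 - c / x * q ^ i) = (\<Prod>i<m. 1 - c / (q * x) * q ^ i) * (1 - c / x * q ^ m / q)"
    using *[of "c / (q * x)"] q_nz by (simp add: mult_ac)
  have "linprod (linlist c m) (q * x) * ((1 - c * x) * (1 - c / x * q ^ m / q))
    = ((1 - c * x) * (\<Prod>i<m. 1 - c * (q * x) * q ^ i)) * ((\<Prod>i<m. 1 - c / (q * x) * q ^ i) * (1 - c / x * q ^ m / q))"
    by (simp only: linprod_linlist mult_ac)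
  also have "\<dots> = (1 - c * x * q ^ m) * (1 - c / (q * x)) * linprod (linlist c m) x"
    unfolding 1 2[symmetric] by (simp only: linprod_linlist mult_ac)
  finally show ?thesis .
qed

text \<open>Same method. Rewriting 1 - c q^m/(q x) and 1 - c/(q x) in terms of the inverted
  arguments leaves a quotient q^m per step, which accounts for the exponent -|m| in the argument of
  the series.\<close>

lemma bilateral_c:
  assumes nz: "c \<noteq> 0" "z \<noteq> 0"
    and num: "\<And>y. qpoch_defined q (q ^ m * c * z) y" "\<And>y. qpoch_defined q (q * z / c) y"
    and den: "\<And>y. qpoch_defined q (c * z) y" "\<And>y. qpoch_defined q (q powi (1 - int m) * z / c) y"
      "\<And>y. qpoch q (c * z) y \<noteq> 0" "\<And>y. qpoch q (q powi (1 - int m) * z / c) y \<noteq> 0"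
    and pz: "linprod (linlist c m) z \<noteq> 0"
  shows "qpoch q (q ^ m * c * z) y * qpoch q (q * z / c) y /
      (qpoch q (c * z) y * qpoch q (q powi (1 - int m) * z / c) y)
    = q powi (int m * y) * (linprod (linlist c m) (z * q powi y) / linprod (linlist c m) z)"
    (is "?f y = ?g y")
proof (rule int_recurrence_unique[where f = ?f and g = ?g])
  define \<rho> where "\<rho> y = (1 - q ^ m * c * z * q powi y) * (1 - q * z / c * q powi y) /
    ((1 - c * z * q powi y) * (1 - q powi (1 - int m) * z / c * q powi y))" for y
  show "?f 0 = ?g 0" using pz by simp
  show "\<rho> y \<noteq> 0" if "y < 0" for y
    using qpoch_definedD[OF num(1) that] qpoch_definedD[OF num(2) that]
      qpoch_nonzeroD[OF den(1) q_nz den(3)] qpoch_nonzeroD[OF den(2) q_nz den(4)]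
    by (simp add: \<rho>_def)
  show "?f (y + 1) = \<rho> y * ?f y" for y
    unfolding qpoch_rec[OF num(1) q_nz] qpoch_rec[OF num(2) q_nz] qpoch_rec[OF den(1) q_nz] qpoch_rec[OF den(2) q_nz]
    by (simp add: \<rho>_def mult_ac)
  show "?g (y + 1) = \<rho> y * ?g y" for y
  proof -
    define x where "x = z * q powi y"
    define L where "L = linprod (linlist c m) x"
    define L' where "L' = linprod (linlist c m) (q * x)"
    have x: "x \<noteq> 0" using nz q_nz by (simp add: x_def)
    have e: "z * q powi (y + 1) = q * x" using q_nz by (simp add: x_def power_int_add)
    have pw: "q powi (int m * (y + 1)) = q ^ m * q powi (int m * y)"
      using q_nz by (simp add: distrib_left power_int_add)
    have qm: "q powi (1 - int m) = q / q ^ m"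
      using q_nz by (simp add: power_int_diff)
    have nd: "1 - c * x \<noteq> 0" "1 - q / q ^ m * x / c \<noteq> 0"
      using qpoch_nonzeroD[OF den(1) q_nz den(3), of y] qpoch_nonzeroD[OF den(2) q_nz den(4), of y]
      unfolding qm by (simp_all add: x_def mult_ac)
    have r: "\<rho> y = (1 - c * x * q ^ m) * (1 - q * x / c) / ((1 - c * x) * (1 - q / q ^ m * x / c))"
      by (simp add: \<rho>_def x_def qm mult_ac)
    have c1: "1 - c / x * q ^ m / q = (1 - q / q ^ m * x / c) * (- (c * q ^ m / (q * x)))"
      using nz x q_nz by (simp add: field_simps)
    have c2: "1 - c / (q * x) = (1 - q * x / c) * (- (c / (q * x)))"
      using nz x q_nz by (simp add: field_simps)
    define t where "t = - (c / (q * x))"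
    have t: "t \<noteq> 0" using nz x q_nz by (simp add: t_def)
    have "L' * ((1 - c * x) * ((1 - q / q ^ m * x / c) * (q ^ m * t))) = (1 - c * x * q ^ m) * ((1 - q * x / c) * t) * L"
      using linprod_linlist_rec[OF x, of c m] unfolding c1 c2 by (simp add: t_def L_def L'_def)
    then have "t * (q ^ m * L' * ((1 - c * x) * (1 - q / q ^ m * x / c))) = t * ((1 - c * x * q ^ m) * (1 - q * x / c) * L)"
      by (simp only: mult_ac)
    then have "q ^ m * L' * ((1 - c * x) * (1 - q / q ^ m * x / c)) = (1 - c * x * q ^ m) * (1 - q * x / c) * L"
      using t by simp
    then have "q ^ m * L' = \<rho> y * L"
      unfolding r using nd by (simp add: eq_divide_eq)
    then show ?thesis
      unfolding e pw x_def[symmetric] L_def[symmetric] L'_def[symmetric] by (simp add: mult_ac)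
  qed
qed

text \<open>The quotients telescope, (a z)_y/(q a z)_y = (1 - a z)/(1 - a z q^y), and likewise for
  z/a. Nonvanishing denominators keep the orbit off \<open>symp a\<close>.\<close>

lemma bilateral_a:
  assumes nz: "a \<noteq> 0" "z \<noteq> 0"
    and num: "\<And>y. qpoch_defined q (a * z) y" "\<And>y. qpoch_defined q (z / a) y"
    and den: "\<And>y. qpoch_defined q (q * a * z) y" "\<And>y. qpoch_defined q (q * z / a) y"
      "\<And>y. qpoch q (q * a * z) y \<noteq> 0" "\<And>y. qpoch q (q * z / a) y \<noteq> 0"
  shows "symp (z * q powi y) \<noteq> symp a"
    and "qpoch q (a * z) y * qpoch q (z / a) y / (qpoch q (q * a * z) y * qpoch q (q * z / a) y)
      = z * (symp z - symp a) / (z * q powi y * (symp (z * q powi y) - symp a))"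
proof -
  define D where "D y = (1 - a * (z * q powi y)) * (1 - z * q powi y / a)" for y
  \<comment> \<open>The factor with q^y occurs in the step of the denominator from y - 1 to y, as q
    a z q^(y-1) = a z q^y.\<close>
  have D: "D y \<noteq> 0" for y
    using qpoch_nonzeroD[OF den(1) q_nz den(3), of "y - 1"] qpoch_nonzeroD[OF den(2) q_nz den(4), of "y - 1"] q_nz
    by (simp add: D_def power_int_diff mult_ac)
  have D_eq: "D y = z * q powi y * (symp (z * q powi y) - symp a)" for y
    unfolding D_def using nz q_nz by (intro symp_diff(1)) auto
  show "symp (z * q powi y) \<noteq> symp a" using D[of y] D_eq[of y] by auto
  define f where "f y = qpoch q (a * z) y * qpoch q (z / a) y / (qpoch q (q * a * z) y * qpoch q (q * z / a) y)" for y
  have "f y = D 0 / D y"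
  proof (rule int_recurrence_unique[where f = f and g = "\<lambda>y. D 0 / D y" and \<rho> = "\<lambda>y. D y / D (y + 1)"])
    show "f (y + 1) = D y / D (y + 1) * f y" for y
      unfolding f_def qpoch_rec[OF num(1) q_nz] qpoch_rec[OF num(2) q_nz] qpoch_rec[OF den(1) q_nz] qpoch_rec[OF den(2) q_nz]
      using q_nz by (simp add: D_def power_int_add mult_ac)
  qed (use D in \<open>auto simp: f_def\<close>)
  then show "qpoch q (a * z) y * qpoch q (z / a) y / (qpoch q (q * a * z) y * qpoch q (q * z / a) y)
      = z * (symp z - symp a) / (z * q powi y * (symp (z * q powi y) - symp a))"
    unfolding f_def D_eq by simp
qed

text \<open>Each pair j < k gives up a factor u_j u_k and each diagonal term a factor u_k; every
  variable lies in n - 1 pairs, whence the power n.\<close>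

lemma W_eq:
  assumes "\<And>k. k \<in> {1..n} \<Longrightarrow> u k \<noteq> 0"
  shows "W n u = (\<Prod>k=1..n. u k ^ n * asym (u k)) * (\<Prod>k=1..n. \<Prod>j=1..<k. symp (u k) - symp (u j))"
proof -
  have pairs: "(\<Prod>k=1..m. u k * (\<Prod>j=1..<k. u j * u k)) = (\<Prod>k=1..m. u k ^ m)" for m
    by (induction m) (simp_all add: prod.distrib atLeastLessThanSuc_atLeastAtMost mult_ac)
  have "W n u = (\<Prod>k=1..n. (\<Prod>j=1..k. 1 - u j * u k) * (\<Prod>j=1..<k. u j - u k))"
    by (simp add: W_def prod.distrib)
  also have "\<dots> = (\<Prod>k=1..n. (u k * (\<Prod>j=1..<k. u j * u k)) * (asym (u k) * (\<Prod>j=1..<k. symp (u k) - symp (u j))))"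
  proof (intro prod.cong refl)
    fix k assume k: "k \<in> {1..n}"
    have "{1..k} = insert k {1..<k}" using k by auto
    then have "(\<Prod>j=1..k. 1 - u j * u k) * (\<Prod>j=1..<k. u j - u k)
        = (1 - u k * u k) * (\<Prod>j=1..<k. (1 - u j * u k) * (u j - u k))"
      by (simp add: prod.distrib)
    also have "1 - u k * u k = u k * asym (u k)"
      using assms[OF k] by (simp add: asym_def field_simps)
    also have "(\<Prod>j=1..<k. (1 - u j * u k) * (u j - u k)) = (\<Prod>j=1..<k. (u j * u k) * (symp (u k) - symp (u j)))"
      using assms k by (intro prod.cong symp_diff(2) refl) auto
    finally show "(\<Prod>j=1..k. 1 - u j * u k) * (\<Prod>j=1..<k. u j - u k)
        = (u k * (\<Prod>j=1..<k. u j * u k)) * (asym (u k) * (\<Prod>j=1..<k. symp (u k) - symp (u j)))"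
      by (simp add: prod.distrib mult_ac)
  qed
  also have "\<dots> = (\<Prod>k=1..n. u k ^ n) * (\<Prod>k=1..n. asym (u k) * (\<Prod>j=1..<k. symp (u k) - symp (u j)))"
    unfolding pairs[symmetric] by (simp only: prod.distrib)
  finally show ?thesis by (simp add: prod.distrib)
qed

section \<open>Continuity in \<open>a\<close> and removal of coincidences\<close>

lemma tendsto_symp:
  "(f \<longlongrightarrow> x) F \<Longrightarrow> x \<noteq> 0 \<Longrightarrow> ((\<lambda>t. symp (f t)) \<longlongrightarrow> symp x) F"
  unfolding symp_def by (intro tendsto_intros)

lemma tendsto_qpair:
  "(f \<longlongrightarrow> u) F \<Longrightarrow> (g \<longlongrightarrow> x) F \<Longrightarrow> x \<noteq> 0 \<Longrightarrow> ((\<lambda>t. qpair (f t) (g t)) \<longlongrightarrow> qpair u x) F"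
  unfolding qpair_def by (intro tendsto_intros)

lemma tendsto_theta4:
  "(f \<longlongrightarrow> u) F \<Longrightarrow> (g \<longlongrightarrow> x) F \<Longrightarrow> u \<noteq> 0 \<Longrightarrow> x \<noteq> 0 \<Longrightarrow> ((\<lambda>t. theta4 (f t) (g t)) \<longlongrightarrow> theta4 u x) F"
  unfolding theta4_def by (intro tendsto_mult tendsto_qpair tendsto_divide tendsto_const)

lemma tendsto_thdiff:
  "(g \<longlongrightarrow> x) F \<Longrightarrow> u \<noteq> 0 \<Longrightarrow> x \<noteq> 0 \<Longrightarrow> ((\<lambda>t. thdiff u (g t)) \<longlongrightarrow> thdiff u x) F"
  unfolding thdiff_def by (intro tendsto_mult tendsto_diff tendsto_symp tendsto_theta4 tendsto_const)

lemma tendsto_linprod: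
  "(g \<longlongrightarrow> x) F \<Longrightarrow> x \<noteq> 0 \<Longrightarrow> ((\<lambda>t. linprod gs (g t)) \<longlongrightarrow> linprod gs x) F"
  unfolding linprod_def by (induction gs) (auto intro!: tendsto_intros)

lemma symp_eq_iff:
  assumes "u \<noteq> 0" "v \<noteq> 0"
  shows "symp u = symp v \<longleftrightarrow> u = v \<or> u * v = 1"
proof -
  have "(1 - u * v) * (u - v) = u * v * (symp v - symp u)"
    using symp_diff(2)[OF assms] .
  then show ?thesis using assms by (metis eq_iff_diff_eq_0 mult_eq_0_iff)
qed

text \<open>
  Both sides of the generic identity are continuous in \<open>a\<close>, so coinciding \<open>symp (a j)\<close> can be
  separated by the perturbation $a_j (1 + t)^j$, $t \to 0$.
\<close>

lemma perturbation_distinct: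
  fixes a :: "nat \<Rightarrow> complex"
  assumes a: "\<And>k. k \<in> {1..n} \<Longrightarrow> a k \<noteq> 0"
  defines "A \<equiv> \<lambda>N j. a j * (1 + of_real (1 / real (Suc N))) ^ j"
  shows "\<forall>\<^sub>F N in sequentially. \<forall>k\<in>{1..n}. \<forall>j\<in>{1..<k}. symp (A N j) \<noteq> symp (A N k)"
proof -
  define e where "e N = 1 + 1 / real (Suc N)" for N
  have e_pos: "e N > 0" for N by (simp add: e_def add_pos_pos)
  have A: "A N j = a j * of_real (e N) ^ j" for N j by (simp add: A_def e_def)
  have inj: "inj (\<lambda>N. of_real (e N) ^ l :: complex)" if "l > 0" for l
  proof (rule injI)
    fix N N' :: nat assume "of_real (e N) ^ l = (of_real (e N') ^ l :: complex)"
    then have "e N ^ l = e N' ^ l" by (metis of_real_eq_iff of_real_power)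
    then have "e N = e N'" using e_pos that by (metis less_imp_le power_eq_imp_eq_base)
    then show "N = N'" by (simp add: e_def)
  qed
  have "\<forall>\<^sub>F N in sequentially. symp (A N j) \<noteq> symp (A N k)" if k: "k \<in> {1..n}" and j: "j \<in> {1..<k}" for j k
  proof -
    have nz: "a j \<noteq> 0" "a k \<noteq> 0" using a k j by auto
    \<comment> \<open>By \<open>symp_eq_iff\<close> a coincidence fixes the power k - j or the power
      j + k of \<open>e N\<close>; both exponents are positive and \<open>e\<close> is injective, so
      finitely many \<open>N\<close> are affected.\<close>
    have "finite ((\<lambda>N. of_real (e N) ^ (k - j) :: complex) -` {a j / a k} \<union> (\<lambda>N. of_real (e N) ^ (j + k) :: complex) -` {1 / (a j * a k)})"
      using j by (intro finite_UnI finite_vimageI inj) auto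
    moreover have "{N. symp (A N j) = symp (A N k)} \<subseteq> (\<lambda>N. of_real (e N) ^ (k - j) :: complex) -` {a j / a k} \<union> (\<lambda>N. of_real (e N) ^ (j + k) :: complex) -` {1 / (a j * a k)}"
    proof
      fix N assume "N \<in> {N. symp (A N j) = symp (A N k)}"
      moreover have "A N j \<noteq> 0" "A N k \<noteq> 0"
        using nz e_pos[of N] by (simp_all add: A)
      ultimately consider "A N j = A N k" | "A N j * A N k = 1"
        using symp_eq_iff by auto
      then show "N \<in> (\<lambda>N. of_real (e N) ^ (k - j) :: complex) -` {a j / a k} \<union> (\<lambda>N. of_real (e N) ^ (j + k) :: complex) -` {1 / (a j * a k)}"
      proof cases
        case 1
        have "of_real (e N) ^ k = (of_real (e N) ^ (k - j) * of_real (e N) ^ j :: complex)"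
          using j by (simp flip: power_add)
        then have "of_real (e N) ^ (k - j) = a j / a k"
          using 1 nz e_pos[of N] by (simp add: A field_simps)
        then show ?thesis by simp
      next
        case 2
        then have "of_real (e N) ^ (j + k) = 1 / (a j * a k)"
          using nz by (simp add: A power_add field_simps)
        then show ?thesis by simp
      qed
    qed
    ultimately have "finite {N. symp (A N j) = symp (A N k)}"
      using finite_subset by blast
    then show ?thesis
      unfolding sequentially_offset cofinite_eq_sequentially[symmetric] eventually_cofinite by simp
  qed
  then show ?thesis by (simp add: eventually_ball_finite)
qed

text \<open>Only the n^2 factors of the denominator depend on \<open>a\<close>, and each changes by
  a factor of at most 2.\<close>

lemma mterm_comparable:
  assumes near: "\<And>j k. j \<in> {1..n} \<Longrightarrow> k \<in> {1..n} \<Longrightarrow>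
      norm (symp (z k * q powi y k) - symp (a j)) \<le> 2 * norm (symp (z k * q powi y k) - symp (a' j))"
    and off: "\<And>j k. j \<in> {1..n} \<Longrightarrow> k \<in> {1..n} \<Longrightarrow> symp (z k * q powi y k) \<noteq> symp (a j)"
      "\<And>j k. j \<in> {1..n} \<Longrightarrow> k \<in> {1..n} \<Longrightarrow> symp (z k * q powi y k) \<noteq> symp (a' j)"
  shows "norm (mterm n Q a' z y) \<le> 2 ^ (n * n) * norm (mterm n Q a z y)"
proof -
  define D where "D a = norm (\<Prod>k=1..n. \<Prod>j=1..n. symp (z k * q powi y k) - symp (a j))" for a
  define T where "T = norm ((\<Prod>k=1..n. asym (z k * q powi y k) * Q (z k * q powi y k) * gauss (z k) (y k)) *
     (\<Prod>k=1..n. \<Prod>j=1..<k. symp (z k * q powi y k) - symp (z j * q powi y j)))"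
  have eq: "norm (mterm n Q a z y) = T / D a" for a
    by (simp add: mterm_def T_def D_def norm_mult norm_divide)
  have "D a \<le> (\<Prod>k=1..n. \<Prod>j=1..n. 2 * norm (symp (z k * q powi y k) - symp (a' j)))"
    unfolding D_def prod_norm[symmetric] by (intro prod_mono conjI prod_nonneg near) auto
  also have "\<dots> = 2 ^ (n * n) * D a'"
    by (simp add: D_def prod_norm prod.distrib power_mult)
  finally have "D a \<le> 2 ^ (n * n) * D a'" .
  moreover have "D a > 0" "D a' > 0"
    using off by (auto simp: D_def)
  ultimately have "1 / D a' \<le> 2 ^ (n * n) * (1 / D a)"
    by (simp add: field_simps)
  then have "T * (1 / D a') \<le> T * (2 ^ (n * n) * (1 / D a))"
    by (rule mult_left_mono) (simp add: T_def)
  then show ?thesis by (simp add: eq mult_ac)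
qed

text \<open>The dominating series comes from the generic case itself: all perturbed terms are
  comparable to the unperturbed one, hence to those of the single generic tuple \<open>B 0\<close>,
  which are already known to be summable.\<close>

proposition has_sum_mterm:
  assumes z: "\<And>k. k \<in> {1..n} \<Longrightarrow> z k \<noteq> 0" and a: "\<And>k. k \<in> {1..n} \<Longrightarrow> a k \<noteq> 0"
    and th: "\<And>j k. j \<in> {1..n} \<Longrightarrow> k \<in> {1..n} \<Longrightarrow> thdiff (z k) (a j) \<noteq> 0"
    and conv: "norm q * (1 / norm q) ^ length gs * (norm b * norm d) < 1"
    and Q: "Q = (\<lambda>x. linprod gs x * qpair b x * qpair d x)"
  shows "((\<lambda>y. mterm n Q a z y) has_sum mvalue n Q a z) (int_tuples n)"
proof -
  define A where "A N j = a j * (1 + of_real (1 / real (Suc N))) ^ j" for N j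
  have A_lim: "(\<lambda>N. A N j) \<longlonglongrightarrow> a j" for j
  proof -
    have lim: "(\<lambda>N. 1 / real (Suc N)) \<longlonglongrightarrow> 0"
      using LIMSEQ_inverse_real_of_nat by (simp add: inverse_eq_divide)
    have "(\<lambda>N. A N j) \<longlonglongrightarrow> a j * (1 + of_real 0) ^ j"
      unfolding A_def by (intro tendsto_intros lim)
    then show ?thesis by simp
  qed
  have A_nz: "A N k \<noteq> 0" if "k \<in> {1..n}" for N k
  proof -
    have "1 + complex_of_real (1 / real (Suc N)) = of_real (1 + 1 / real (Suc N))" by simp
    moreover have "1 + 1 / real (Suc N) > 0" by (intro add_pos_pos) auto
    ultimately have "1 + complex_of_real (1 / real (Suc N)) \<noteq> 0"
      by (metis of_real_eq_0_iff less_irrefl)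
    then show ?thesis using a[OF that] by (simp add: A_def)
  qed
  have off: "symp (z k * q powi y) \<noteq> symp (a j)" if "j \<in> {1..n}" "k \<in> {1..n}" for j k y
    using thdiff_nonzeroD'[OF th[OF that] z[OF that(2)] a[OF that(1)]] .
  have "\<forall>\<^sub>F N in sequentially. \<forall>y. norm (symp (a j) - symp (A N j)) \<le> norm (symp (z k * q powi y) - symp (a j)) / 2"
    if jk: "j \<in> {1..n}" "k \<in> {1..n}" for j k
  proof -
    obtain \<delta> where \<delta>: "\<delta> > 0" "\<And>y. norm (symp (z k * q powi y) - symp (a j)) \<ge> \<delta>"
      using orbit_gap[OF z[OF jk(2)] off[OF jk]] by blast
    have "(\<lambda>N. norm (symp (a j) - symp (A N j))) \<longlonglongrightarrow> norm (symp (a j) - symp (a j))"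
      by (intro tendsto_norm tendsto_diff tendsto_const tendsto_symp A_lim a jk)
    then have "\<forall>\<^sub>F N in sequentially. norm (symp (a j) - symp (A N j)) < \<delta> / 2"
      using \<delta>(1) by (intro order_tendstoD(2)) auto
    then show ?thesis
      by eventually_elim (meson \<delta>(2) divide_right_mono less_imp_le order_trans zero_le_numeral)
  qed
  then have "\<forall>\<^sub>F N in sequentially. \<forall>k\<in>{1..n}. \<forall>j\<in>{1..n}. \<forall>y.
      norm (symp (a j) - symp (A N j)) \<le> norm (symp (z k * q powi y) - symp (a j)) / 2"
    by (simp add: eventually_ball_finite)
  moreover have "\<forall>\<^sub>F N in sequentially. thdiff (z k) (A N j) \<noteq> 0" if "j \<in> {1..n}" "k \<in> {1..n}" for j k
    by (rule tendsto_imp_eventually_ne[OF tendsto_thdiff[OF A_lim]]) (use z a th that in auto)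
  then have "\<forall>\<^sub>F N in sequentially. \<forall>k\<in>{1..n}. \<forall>j\<in>{1..n}. thdiff (z k) (A N j) \<noteq> 0"
    by (simp add: eventually_ball_finite)
  moreover have "\<forall>\<^sub>F N in sequentially. \<forall>k\<in>{1..n}. \<forall>j\<in>{1..<k}. symp (A N j) \<noteq> symp (A N k)"
    unfolding A_def by (rule perturbation_distinct) (rule a)
  ultimately have "\<forall>\<^sub>F N in sequentially.
      (\<forall>k\<in>{1..n}. \<forall>j\<in>{1..n}. \<forall>y. norm (symp (a j) - symp (A N j)) \<le> norm (symp (z k * q powi y) - symp (a j)) / 2) \<and>
      (\<forall>k\<in>{1..n}. \<forall>j\<in>{1..n}. thdiff (z k) (A N j) \<noteq> 0) \<and>
      (\<forall>k\<in>{1..n}. \<forall>j\<in>{1..<k}. symp (A N j) \<noteq> symp (A N k))"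
    by (simp add: eventually_conj_iff)
  then obtain N0 where N0: "\<And>N. N \<ge> N0 \<Longrightarrow>
      (\<forall>k\<in>{1..n}. \<forall>j\<in>{1..n}. \<forall>y. norm (symp (a j) - symp (A N j)) \<le> norm (symp (z k * q powi y) - symp (a j)) / 2) \<and>
      (\<forall>k\<in>{1..n}. \<forall>j\<in>{1..n}. thdiff (z k) (A N j) \<noteq> 0) \<and>
      (\<forall>k\<in>{1..n}. \<forall>j\<in>{1..<k}. symp (A N j) \<noteq> symp (A N k))"
    unfolding eventually_sequentially by blast
  \<comment> \<open>The shift by \<open>N0\<close> makes the eventual properties hold for every
    index.\<close>
  define B where "B N = A (N + N0)" for N
  have B_nz: "B N k \<noteq> 0" if "k \<in> {1..n}" for N k
    using A_nz[OF that] by (simp add: B_def)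
  have B_lim: "(\<lambda>N. B N j) \<longlonglongrightarrow> a j" for j
    unfolding B_def using A_lim by (rule LIMSEQ_ignore_initial_segment)
  have B_near: "norm (symp (a j) - symp (B N j)) \<le> norm (symp (z k * q powi y) - symp (a j)) / 2"
    and B_th: "thdiff (z k) (B N j) \<noteq> 0" if "j \<in> {1..n}" "k \<in> {1..n}" for j k N y
    using N0[of "N + N0"] that by (auto simp: B_def)
  have B_distinct: "symp (B N j) \<noteq> symp (B N k)" if "k \<in> {1..n}" "j \<in> {1..<k}" for j k N
    using N0[of "N + N0"] that by (auto simp: B_def)
  have B_off: "symp (z k * q powi y) \<noteq> symp (B N j)" if "j \<in> {1..n}" "k \<in> {1..n}" for j k y N
    using thdiff_nonzeroD'[OF B_th[OF that] z[OF that(2)] B_nz[OF that(1)]] .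
  have le1: "norm (mterm n Q (B N) z y) \<le> 2 ^ (n * n) * norm (mterm n Q a z y)" for N y
  proof (rule mterm_comparable)
    fix j k assume jk: "j \<in> {1..n}" "k \<in> {1..n}"
    show "norm (symp (z k * q powi y k) - symp (a j)) \<le> 2 * norm (symp (z k * q powi y k) - symp (B N j))"
      using B_near[OF jk, of N "y k"] norm_triangle_ineq2[of "symp (z k * q powi y k) - symp (a j)" "symp (B N j) - symp (a j)"]
      by (simp add: norm_minus_commute)
  qed (use off B_off in auto)
  have le2: "norm (mterm n Q a z y) \<le> 2 ^ (n * n) * norm (mterm n Q (B N) z y)" for N y
  proof (rule mterm_comparable)
    fix j k assume jk: "j \<in> {1..n}" "k \<in> {1..n}"
    have "norm (symp (z k * q powi y k) - symp (B N j)) \<le>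
        norm (symp (z k * q powi y k) - symp (a j)) + norm (symp (a j) - symp (B N j))"
      using norm_triangle_ineq[of "symp (z k * q powi y k) - symp (a j)" "symp (a j) - symp (B N j)"] by simp
    then show "norm (symp (z k * q powi y k) - symp (B N j)) \<le> 2 * norm (symp (z k * q powi y k) - symp (a j))"
      using B_near[OF jk, of N "y k"] norm_ge_zero[of "symp (z k * q powi y k) - symp (a j)"] by linarith
  qed (use off B_off in auto)
  have B_sum: "((\<lambda>y. mterm n Q (B N) z y) has_sum mvalue n Q (B N) z) (int_tuples n)" for N
    by (rule has_sum_mterm_generic[OF z B_nz B_th B_distinct conv Q])
  show ?thesis
  proof (rule has_sum_dominated_limit[OF B_sum])
    define C :: real where "C = 2 ^ (n * n) * 2 ^ (n * n)"
    show "norm (mterm n Q (B N) z y) \<le> C * norm (mterm n Q (B 0) z y)" for N y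
    proof -
      have "2 ^ (n * n) * norm (mterm n Q a z y) \<le> 2 ^ (n * n) * (2 ^ (n * n) * norm (mterm n Q (B 0) z y))"
        using le2[of y 0] by (intro mult_left_mono) auto
      from order_trans[OF le1[of N y] this] show ?thesis by (simp only: C_def mult.assoc)
    qed
    have "(\<lambda>y. norm (mterm n Q (B 0) z y)) summable_on int_tuples n"
      using has_sum_imp_summable[OF B_sum[of 0]] by (rule iffD1[OF summable_on_iff_abs_summable_on_complex])
    then show "(\<lambda>y. C * norm (mterm n Q (B 0) z y)) summable_on int_tuples n"
      by (rule summable_on_cmult_right)
    show "(\<lambda>N. mterm n Q (B N) z y) \<longlonglongrightarrow> mterm n Q a z y" for y
      unfolding mterm_def
      by (intro tendsto_mult tendsto_divide tendsto_prod tendsto_diff tendsto_const tendsto_symp B_lim a)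
         (use off in auto)
    show "(\<lambda>N. mvalue n Q (B N) z) \<longlonglongrightarrow> mvalue n Q a z"
      unfolding mvalue_def Q
      by (intro tendsto_mult tendsto_divide tendsto_prod tendsto_const tendsto_linprod tendsto_qpair
          tendsto_theta4 tendsto_thdiff B_lim) (use z a th in auto)
  qed
qed

end

section \<open>The summation formula\<close>

lemma power_int_sum:
  fixes t :: complex
  assumes "t \<noteq> 0" "finite K"
  shows "t powi (\<Sum>k\<in>K. f k) = (\<Prod>k\<in>K. t powi f k)"
  using assms(2) by (induction K rule: finite_induct) (simp_all add: power_int_add assms(1))

context qbase
begin

lemma linprod_concat: "linprod (concat (map f js)) x = (\<Prod>j\<leftarrow>js. linprod (f j) x)"
  by (induction js) (simp_all add: linprod_append, simp add: linprod_def)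

lemma linprod_linlist_qpoch: "linprod (linlist c m) x = qpoch q (c * x) (int m) * qpoch q (c / x) (int m)"
  by (simp add: linprod_linlist qpoch_def)

end

theorem corollary4p2:
  fixes q b d :: complex
    and n p M :: nat
    and m :: "nat \<Rightarrow> nat"
    and a c z :: "nat \<Rightarrow> complex"
  assumes q: "0 < norm q" "norm q < 1"
    and n: "n \<ge> 1" and p: "p \<ge> 1"
    and M: "M = (\<Sum>j=1..p. m j)"
    and conv: "norm (q powi (1 - int M) / (b * d)) < 1"
    and nonzero: "b \<noteq> 0" "d \<noteq> 0"
      "\<And>k. k \<in> {1..n} \<Longrightarrow> a k \<noteq> 0"
      "\<And>k. k \<in> {1..n} \<Longrightarrow> z k \<noteq> 0"
      "\<And>j. j \<in> {1..p} \<Longrightarrow> c j \<noteq> 0"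
    and W_nonzero: "W n z \<noteq> 0"
    and lhs_c: "\<And>j k y. j \<in> {1..p} \<Longrightarrow> k \<in> {1..n} \<Longrightarrow>
      qpochs_defined q [q ^ m j * c j * z k, q * z k / c j] y \<and>
      qpochs_defined q [c j * z k, q powi (1 - int (m j)) * z k / c j] y \<and>
      qpochs q [c j * z k, q powi (1 - int (m j)) * z k / c j] y \<noteq> 0"
    and lhs_a: "\<And>j k y. j \<in> {1..n} \<Longrightarrow> k \<in> {1..n} \<Longrightarrow>
      qpochs_defined q [a j * z k, z k / a j] y \<and>
      qpochs_defined q [q * a j * z k, q * z k / a j] y \<and>
      qpochs q [q * a j * z k, q * z k / a j] y \<noteq> 0"
    and lhs_bd: "\<And>k y. k \<in> {1..n} \<Longrightarrow>
      qpochs_defined q [b * z k, d * z k] y \<and>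
      qpochs_defined q [q * z k / b, q * z k / d] y \<and>
      qpochs q [q * z k / b, q * z k / d] y \<noteq> 0"
    and rhs_a: "\<And>j k. j \<in> {1..n} \<Longrightarrow> k \<in> {1..n} \<Longrightarrow>
      qpochs_inf q [q * z k / a j, q * z k * a j, q / (a j * z k), q * a j / z k] \<noteq> 0"
    and rhs_bd: "\<And>k. k \<in> {1..n} \<Longrightarrow>
      qpochs_inf q [q * z k / b, q / (z k * b), q * z k / d, q / (z k * d)] \<noteq> 0"
    and rhs_c: "\<And>j k. j \<in> {1..p} \<Longrightarrow> k \<in> {1..n} \<Longrightarrow>
      qpochs q [c j * z k, c j / z k] (int (m j)) \<noteq> 0"
  shows "((\<lambda>y.
      W n (qshift q z y) / W n z *
      (\<Prod>k=1..n. \<Prod>j=1..p.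
         qpochs q [q ^ m j * c j * z k, q * z k / c j] (y k) /
         qpochs q [c j * z k, q powi (1 - int (m j)) * z k / c j] (y k)) *
      (\<Prod>j=1..n. \<Prod>k=1..n.
         qpochs q [a j * z k, z k / a j] (y k) /
         qpochs q [q * a j * z k, q * z k / a j] (y k)) *
      (\<Prod>k=1..n.
         qpochs q [b * z k, d * z k] (y k) /
         qpochs q [q * z k / b, q * z k / d] (y k)) *
      (q powi (1 - int M) / (b * d)) powi (\<Sum>k=1..n. y k))
    has_sum
      ((\<Prod>j=1..n. \<Prod>k=1..n.
         qpochs_inf q [q * z k / z j, q * a k / a j] /
         qpochs_inf q [q * z k / a j, q * z k * a j, q / (a j * z k), q * a j / z k]) *
      (\<Prod>k=1..n.
         qpochs_inf q [q * a k / b, q / (a k * b), q * a k / d, q / (a k * d)] /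
         qpochs_inf q [q * z k / b, q / (z k * b), q * z k / d, q / (z k * d)]) *
      (\<Prod>k=1..n. \<Prod>j=1..k. qpochs_inf q [q * z j * z k, q / (z j * z k)]) *
      (\<Prod>k=1..n. \<Prod>j=1..<k. qpochs_inf q [q * a j * a k, q / (a j * a k)]) *
      (\<Prod>k=1..n. \<Prod>j=1..p.
         qpochs q [c j * a k, c j / a k] (int (m j)) /
         qpochs q [c j * z k, c j / z k] (int (m j)))))
    (int_tuples n)"
proof -
  interpret qbase q
    using q by unfold_locales auto
  define K where "K = {1..n}"
  define gs where "gs = concat (map (\<lambda>j. linlist (c j) (m j)) [1..<Suc p])"
  \<comment> \<open>The reciprocals appear because \<open>qpair (1 / b) x\<close> is (q x/b)_inf
    (q/(x b))_inf.\<close>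
  define Q where "Q = (\<lambda>x. linprod gs x * qpair (1 / b) x * qpair (1 / d) x)"
  define x where "x y k = z k * q powi y k" for y :: "nat \<Rightarrow> int" and k
  note z_nz = nonzero(4) and a_nz = nonzero(3)
  have x_nz: "x y k \<noteq> 0" if "k \<in> {1..n}" for y k
    using z_nz[OF that] q_nz by (simp add: x_def)
  have linprod_gs: "linprod gs w = (\<Prod>j=1..p. qpochs q [c j * w, c j / w] (int (m j)))" for w
  proof -
    have "linprod gs w = (\<Prod>j\<leftarrow>[1..<Suc p]. linprod (linlist (c j) (m j)) w)"
      unfolding gs_def by (rule linprod_concat)
    also have "\<dots> = (\<Prod>j\<in>set [1..<Suc p]. linprod (linlist (c j) (m j)) w)"
      by (rule prod.distinct_set_conv_list[symmetric]) simp
    finally show ?thesis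
      by (simp add: linprod_linlist_qpoch qpochs_def atLeastLessThanSuc_atLeastAtMost del: upt_Suc)
  qed
  have len: "length gs = M"
  proof -
    have "length gs = (\<Sum>j\<leftarrow>[1..<Suc p]. m j)"
      by (simp add: gs_def length_concat o_def linlist_def del: upt_Suc)
    then show ?thesis
      by (simp add: M interv_sum_list_conv_sum_set_nat atLeastLessThanSuc_atLeastAtMost del: upt_Suc)
  qed
  have qM: "q powi (1 - int M) = q / q ^ M"
    using q_nz by (simp add: power_int_diff)
  have conv': "norm q * (1 / norm q) ^ length gs * (norm (1 / b) * norm (1 / d)) < 1"
    using conv unfolding qM len by (simp add: norm_mult norm_power norm_inverse power_inverse divide_inverse mult_ac)

  have theta: "theta4 (z k) (a j) = qpochs_inf q [q * z k / a j, q * z k * a j, q / (a j * z k), q * a j / z k]" for j k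
    by (simp add: theta4_def qpair_def qpochs_inf_def mult_ac)
  have off: "symp (x y k) \<noteq> symp (a j)"
    and a_factor: "qpochs q [a j * z k, z k / a j] (y k) / qpochs q [q * a j * z k, q * z k / a j] (y k)
      = z k * (symp (z k) - symp (a j)) / (x y k * (symp (x y k) - symp (a j)))"
    if jk: "j \<in> {1..n}" "k \<in> {1..n}" for j k and y :: "nat \<Rightarrow> int"
    using bilateral_a[OF a_nz[OF jk(1)] z_nz[OF jk(2)], of "y k"] lhs_a[OF jk]
    by (auto simp: qpochs_def qpochs_defined_def x_def)
  have off0: "symp (z k) \<noteq> symp (a j)" if "j \<in> {1..n}" "k \<in> {1..n}" for j k
    using off[OF that, of "\<lambda>_. 0"] by (simp add: x_def)
  \<comment> \<open>Left-hand denominators exclude \<open>symp (z k) = symp (a j)\<close>,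
    right-hand denominators are \<open>theta4\<close>; together they form
    \<open>thdiff\<close>.\<close>
  have th: "thdiff (z k) (a j) \<noteq> 0" if jk: "j \<in> {1..n}" "k \<in> {1..n}" for j k
    using rhs_a[OF jk] off0[OF jk] by (simp add: thdiff_def theta)
  have pz: "qpair (1 / b) (z k) \<noteq> 0" "qpair (1 / d) (z k) \<noteq> 0" if "k \<in> {1..n}" for k
    using rhs_bd[OF that] by (simp_all add: qpair_def qpochs_inf_def mult_ac)
  have cz: "linprod (linlist (c j) (m j)) (z k) \<noteq> 0" if "j \<in> {1..p}" "k \<in> {1..n}" for j k
    using rhs_c[OF that] by (simp add: linprod_linlist_qpoch qpochs_def)
  have lz: "linprod gs (z k) \<noteq> 0" if "k \<in> {1..n}" for k
    using rhs_c[OF _ that] by (simp add: linprod_gs)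
  have Qz: "Q (z k) \<noteq> 0" if "k \<in> {1..n}" for k
    using lz[OF that] pz[OF that] by (simp add: Q_def)

  define V where "V u = (\<Prod>k=1..n. \<Prod>j=1..<k. symp (u k) - symp (u j))" for u
  define D where "D u = (\<Prod>k=1..n. \<Prod>j=1..n. symp (u k) - symp (a j))" for u
  \<comment> \<open>The value of \<open>mterm\<close> at y = 0, by which the series of the theorem
    is normalised.\<close>
  define C where "C = (\<Prod>k=1..n. asym (z k) * Q (z k)) * (V z / D z)"
  have W_z: "W n z = (\<Prod>k=1..n. z k ^ n * asym (z k)) * V z"
    unfolding V_def by (rule W_eq) (rule z_nz)
  have asym_z: "(\<Prod>k=1..n. asym (z k)) \<noteq> 0" and V_z: "V z \<noteq> 0"
    using W_nonzero unfolding W_z by auto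
  have D_z: "D z \<noteq> 0"
    using off0 by (simp add: D_def)
  have D_x: "D (x y) \<noteq> 0" for y
    using off by (simp add: D_def)

  have W_part: "W n (qshift q z y) / W n z * (\<Prod>j=1..n. \<Prod>k=1..n.
         qpochs q [a j * z k, z k / a j] (y k) / qpochs q [q * a j * z k, q * z k / a j] (y k))
      = (\<Prod>k=1..n. asym (x y k) / asym (z k)) * (V (x y) / D (x y)) / (V z / D z)" for y
  proof -
    have Wx: "W n (qshift q z y) = (\<Prod>k=1..n. x y k ^ n * asym (x y k)) * V (x y)"
    proof -
      have "qshift q z y = x y" by (simp add: qshift_def x_def fun_eq_iff)
      then show ?thesis
        unfolding V_def by (simp only:) (rule W_eq, rule x_nz)
    qed
    have "(\<Prod>j=1..n. \<Prod>k=1..n.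
         qpochs q [a j * z k, z k / a j] (y k) / qpochs q [q * a j * z k, q * z k / a j] (y k))
       = (\<Prod>j=1..n. \<Prod>k=1..n. z k * (symp (z k) - symp (a j)) / (x y k * (symp (x y k) - symp (a j))))"
      by (intro prod.cong refl a_factor)
    also have "\<dots> = (\<Prod>k=1..n. \<Prod>j=1..n. z k * (symp (z k) - symp (a j)) / (x y k * (symp (x y k) - symp (a j))))"
      by (rule prod.swap)
    \<comment> \<open>These n-th powers cancel those produced by \<open>W_eq\<close>.\<close>
    also have "\<dots> = (\<Prod>k=1..n. z k ^ n) * D z / ((\<Prod>k=1..n. x y k ^ n) * D (x y))"
      by (simp add: D_def prod_dividef prod.distrib)
    finally show ?thesis
      unfolding Wx W_z using z_nz x_nz by (simp add: prod.distrib prod_dividef mult_ac)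
  qed

  have c_part: "(\<Prod>j=1..p.
         qpochs q [q ^ m j * c j * z k, q * z k / c j] (y k) /
         qpochs q [c j * z k, q powi (1 - int (m j)) * z k / c j] (y k))
      = q powi (int M * y k) * (linprod gs (x y k) / linprod gs (z k))" if k: "k \<in> {1..n}" for k and y :: "nat \<Rightarrow> int"
  proof -
    have "(\<Prod>j=1..p.
         qpochs q [q ^ m j * c j * z k, q * z k / c j] (y k) /
         qpochs q [c j * z k, q powi (1 - int (m j)) * z k / c j] (y k))
      = (\<Prod>j=1..p. q powi (int (m j) * y k) *
          (linprod (linlist (c j) (m j)) (x y k) / linprod (linlist (c j) (m j)) (z k)))"
    proof (intro prod.cong refl)
      fix j assume j: "j \<in> {1..p}"
      show "qpochs q [q ^ m j * c j * z k, q * z k / c j] (y k) /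
         qpochs q [c j * z k, q powi (1 - int (m j)) * z k / c j] (y k)
        = q powi (int (m j) * y k) * (linprod (linlist (c j) (m j)) (x y k) / linprod (linlist (c j) (m j)) (z k))"
        using bilateral_c[OF nonzero(5)[OF j] z_nz[OF k], of "m j" "y k"] lhs_c[OF j k] cz[OF j k]
        by (simp add: qpochs_def qpochs_defined_def x_def)
    qed
    also have "\<dots> = q powi (\<Sum>j=1..p. int (m j) * y k) * (linprod gs (x y k) / linprod gs (z k))"
      by (simp add: power_int_sum[OF q_nz] prod.distrib prod_dividef linprod_gs linprod_linlist_qpoch qpochs_def)
    finally show ?thesis by (simp add: M sum_distrib_right)
  qed

  have bd_part: "qpochs q [b * z k, d * z k] (y k) / qpochs q [q * z k / b, q * z k / d] (y k) * (q / (b * d)) powi y k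
      = gauss (z k) (y k) * (qpair (1 / b) (x y k) * qpair (1 / d) (x y k)) / (qpair (1 / b) (z k) * qpair (1 / d) (z k))"
    if k: "k \<in> {1..n}" for k and y :: "nat \<Rightarrow> int"
    using bilateral_bd[OF nonzero(1,2) z_nz[OF k], of "y k"] lhs_bd[OF k] pz[OF k]
    by (simp add: qpochs_def qpochs_defined_def x_def)

  have factor: "(\<Prod>j=1..p.
         qpochs q [q ^ m j * c j * z k, q * z k / c j] (y k) /
         qpochs q [c j * z k, q powi (1 - int (m j)) * z k / c j] (y k)) *
       (qpochs q [b * z k, d * z k] (y k) / qpochs q [q * z k / b, q * z k / d] (y k)) *
       (q powi (1 - int M) / (b * d)) powi y k
     = Q (x y k) * gauss (z k) (y k) / Q (z k)" if k: "k \<in> {1..n}" for k and y :: "nat \<Rightarrow> int"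
  proof -
    \<comment> \<open>The argument is split: q/(b d) belongs to \<open>bd_part\<close>, and the
      power of 1/q^M cancels the one from \<open>c_part\<close>.\<close>
    have "(q powi (1 - int M) / (b * d)) powi y k = ((q / (b * d)) / q ^ M) powi y k"
      by (simp add: qM mult_ac)
    also have "\<dots> = (q / (b * d)) powi y k / q powi (int M * y k)"
      by (simp only: power_int_divide_distrib power_int_mult power_int_of_nat)
    finally have pw: "(q powi (1 - int M) / (b * d)) powi y k = (q / (b * d)) powi y k / q powi (int M * y k)" .
    have "(\<Prod>j=1..p.
         qpochs q [q ^ m j * c j * z k, q * z k / c j] (y k) /
         qpochs q [c j * z k, q powi (1 - int (m j)) * z k / c j] (y k)) *
       (qpochs q [b * z k, d * z k] (y k) / qpochs q [q * z k / b, q * z k / d] (y k)) *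
       (q powi (1 - int M) / (b * d)) powi y k
      = (linprod gs (x y k) / linprod gs (z k)) *
        (qpochs q [b * z k, d * z k] (y k) / qpochs q [q * z k / b, q * z k / d] (y k) * (q / (b * d)) powi y k)"
      unfolding c_part[OF k] pw using q_nz by simp
    then show ?thesis
      unfolding bd_part[OF k] by (simp add: Q_def mult_ac)
  qed

  have lhs: "W n (qshift q z y) / W n z *
      (\<Prod>k=1..n. \<Prod>j=1..p.
         qpochs q [q ^ m j * c j * z k, q * z k / c j] (y k) /
         qpochs q [c j * z k, q powi (1 - int (m j)) * z k / c j] (y k)) *
      (\<Prod>j=1..n. \<Prod>k=1..n.
         qpochs q [a j * z k, z k / a j] (y k) /
         qpochs q [q * a j * z k, q * z k / a j] (y k)) *
      (\<Prod>k=1..n.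
         qpochs q [b * z k, d * z k] (y k) /
         qpochs q [q * z k / b, q * z k / d] (y k)) *
      (q powi (1 - int M) / (b * d)) powi (\<Sum>k=1..n. y k) = (1 / C) * mterm n Q a z y" for y
  proof -
    define c1 where "c1 k = (\<Prod>j=1..p.
         qpochs q [q ^ m j * c j * z k, q * z k / c j] (y k) /
         qpochs q [c j * z k, q powi (1 - int (m j)) * z k / c j] (y k))" for k
    define c2 where "c2 k = qpochs q [b * z k, d * z k] (y k) / qpochs q [q * z k / b, q * z k / d] (y k)" for k
    define t where "t = q powi (1 - int M) / (b * d)"
    define w where "w = W n (qshift q z y) / W n z"
    define s where "s = (\<Prod>j=1..n. \<Prod>k=1..n.
         qpochs q [a j * z k, z k / a j] (y k) / qpochs q [q * a j * z k, q * z k / a j] (y k))"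
    have t: "t \<noteq> 0" using nonzero q_nz by (simp add: t_def)
    have "w * (\<Prod>k=1..n. c1 k) * s * (\<Prod>k=1..n. c2 k) * t powi (\<Sum>k=1..n. y k)
      = (w * s) * (\<Prod>k=1..n. c1 k * c2 k * t powi y k)"
      by (simp add: power_int_sum[OF t] prod.distrib mult_ac)
    also have "(\<Prod>k=1..n. c1 k * c2 k * t powi y k) = (\<Prod>k=1..n. Q (x y k) * gauss (z k) (y k) / Q (z k))"
      unfolding c1_def c2_def t_def by (intro prod.cong refl factor)
    also have "w * s = (\<Prod>k=1..n. asym (x y k) / asym (z k)) * (V (x y) / D (x y)) / (V z / D z)"
      unfolding w_def s_def by (rule W_part)
    also have "\<dots> * (\<Prod>k=1..n. Q (x y k) * gauss (z k) (y k) / Q (z k)) = (1 / C) * mterm n Q a z y"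
      by (simp add: C_def mterm_def V_def D_def x_def prod.distrib prod_dividef mult_ac)
    finally show ?thesis
      unfolding w_def s_def c1_def c2_def t_def .
  qed

  \<comment> \<open>In the quotient by \<open>C\<close> every difference of \<open>symp\<close>
    values cancels, leaving the \<open>theta4\<close> parts.\<close>
  define T where "T = (\<Prod>k=1..n. \<Prod>j=1..<k. theta4 (z k) (z j) * theta4 (a j) (a k))"
  define U where "U = (\<Prod>k=1..n. \<Prod>j=1..n. theta4 (z k) (a j))"
  define E where "E = (\<Prod>k=1..n. qpoch_inf q q ^ 2 * (qpoch_inf q (q * z k ^ 2) * qpoch_inf q (q / z k ^ 2)))"

  have mvalue_eq: "(1 / C) * mvalue n Q a z = (\<Prod>k=1..n. Q (a k) / Q (z k)) * E * (T / U)"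
  proof -
    have 1: "(\<Prod>k=1..n. Q (a k) * kappa (z k)) = (\<Prod>k=1..n. Q (a k)) * (\<Prod>k=1..n. asym (z k)) * E"
      by (simp add: kappa_def E_def prod.distrib mult_ac)
    have 2: "(\<Prod>k=1..n. \<Prod>j=1..<k. thdiff (z k) (z j) * theta4 (a j) (a k)) = V z * T"
      by (simp add: V_def T_def thdiff_def prod.distrib mult_ac)
    have 3: "(\<Prod>k=1..n. \<Prod>j=1..n. thdiff (z k) (a j)) = D z * U"
      by (simp add: D_def U_def thdiff_def prod.distrib)
    have 4: "(\<Prod>k=1..n. asym (z k) * Q (z k)) = (\<Prod>k=1..n. asym (z k)) * (\<Prod>k=1..n. Q (z k))"
      by (rule prod.distrib)
    define A where "A = (\<Prod>k=1..n. asym (z k))"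
    show ?thesis
      using asym_z V_z D_z unfolding mvalue_def C_def 1 2 3 4 prod_dividef A_def[symmetric]
      by (simp add: mult_ac)
  qed

  define R1 where "R1 = (\<Prod>j=1..n. \<Prod>k=1..n.
         qpochs_inf q [q * z k / z j, q * a k / a j] /
         qpochs_inf q [q * z k / a j, q * z k * a j, q / (a j * z k), q * a j / z k])"
  define R2 where "R2 = (\<Prod>k=1..n.
         qpochs_inf q [q * a k / b, q / (a k * b), q * a k / d, q / (a k * d)] /
         qpochs_inf q [q * z k / b, q / (z k * b), q * z k / d, q / (z k * d)])"
  define R3 where "R3 = (\<Prod>k=1..n. \<Prod>j=1..k. qpochs_inf q [q * z j * z k, q / (z j * z k)])"
  define R4 where "R4 = (\<Prod>k=1..n. \<Prod>j=1..<k. qpochs_inf q [q * a j * a k, q / (a j * a k)])"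
  define R5 where "R5 = (\<Prod>k=1..n. \<Prod>j=1..p.
         qpochs q [c j * a k, c j / a k] (int (m j)) /
         qpochs q [c j * z k, c j / z k] (int (m j)))"

  have "R2 * R5 = (\<Prod>k=1..n. Q (a k) / Q (z k))"
  proof -
    have bd: "qpochs_inf q [q * u / b, q / (u * b), q * u / d, q / (u * d)] = qpair (1 / b) u * qpair (1 / d) u" for u
      by (simp add: qpair_def qpochs_inf_def mult_ac)
    show ?thesis
      unfolding R2_def R5_def Q_def linprod_gs bd prod_dividef prod.distrib by (simp add: mult_ac)
  qed
  moreover have "R1 * R3 * R4 = E * (T / U)"
  proof -
    \<comment> \<open>The diagonal of the square is a power of (q)_inf, and its off-diagonal pairs
      supply half of each \<open>theta4\<close> in \<open>T\<close>; the products for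
      \<open>R3\<close> and \<open>R4\<close> supply the other half.\<close>
    have sq: "(\<Prod>j=1..n. \<Prod>k=1..n. qpoch_inf q (q * u k / u j))
        = (\<Prod>k=1..n. qpoch_inf q q) * (\<Prod>k=1..n. \<Prod>j=1..<k. qpoch_inf q (q * u k / u j) * qpoch_inf q (q * u j / u k))"
      if "\<forall>k\<in>{1..n}. u k \<noteq> 0" for u
      using prod_square[of "\<lambda>j k. qpoch_inf q (q * u k / u j)" n] that by simp
    have th4: "theta4 u v = (qpoch_inf q (q * u / v) * qpoch_inf q (q * v / u)) * qpochs_inf q [q * v * u, q / (v * u)]" for u v
      by (simp add: theta4_def qpair_def qpochs_inf_def mult_ac)
    have U: "(\<Prod>j=1..n. \<Prod>k=1..n. qpochs_inf q [q * z k / a j, q * z k * a j, q / (a j * z k), q * a j / z k]) = U"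
      unfolding U_def theta by (rule prod.swap)
    have R1_eq: "R1 = (\<Prod>j=1..n. \<Prod>k=1..n. qpoch_inf q (q * z k / z j)) * (\<Prod>j=1..n. \<Prod>k=1..n. qpoch_inf q (q * a k / a j)) / U"
      unfolding R1_def prod_dividef U by (simp add: qpochs_inf_def prod.distrib)
    have R3_eq: "R3 = (\<Prod>k=1..n. qpoch_inf q (q * z k ^ 2) * qpoch_inf q (q / z k ^ 2)) *
        (\<Prod>k=1..n. \<Prod>j=1..<k. qpochs_inf q [q * z j * z k, q / (z j * z k)])"
      unfolding R3_def prod.distrib[symmetric]
    proof (intro prod.cong refl)
      fix k assume "k \<in> {1..n}"
      then have "{1..k} = insert k {1..<k}" by auto
      then show "(\<Prod>j=1..k. qpochs_inf q [q * z j * z k, q / (z j * z k)])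
        = qpoch_inf q (q * z k ^ 2) * qpoch_inf q (q / z k ^ 2) * (\<Prod>j=1..<k. qpochs_inf q [q * z j * z k, q / (z j * z k)])"
        by (simp add: qpochs_inf_def power2_eq_square mult_ac)
    qed
    have T_eq: "T = ((\<Prod>k=1..n. \<Prod>j=1..<k. qpoch_inf q (q * z k / z j) * qpoch_inf q (q * z j / z k)) *
        (\<Prod>k=1..n. \<Prod>j=1..<k. qpochs_inf q [q * z j * z k, q / (z j * z k)])) *
        ((\<Prod>k=1..n. \<Prod>j=1..<k. qpoch_inf q (q * a k / a j) * qpoch_inf q (q * a j / a k)) * R4)"
      unfolding T_def R4_def prod.distrib[symmetric]
      by (intro prod.cong refl) (simp add: th4[of "z _" "z _"] theta4_commute[of "a _" "a _"], simp add: th4 mult_ac)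
    have E_eq: "E = (\<Prod>k=1..n. qpoch_inf q q) * (\<Prod>k=1..n. qpoch_inf q q) *
        (\<Prod>k=1..n. qpoch_inf q (q * z k ^ 2) * qpoch_inf q (q / z k ^ 2))"
      unfolding E_def prod.distrib[symmetric] by (intro prod.cong refl) (simp add: power2_eq_square mult_ac)
    have "\<forall>k\<in>{1..n}. z k \<noteq> 0" "\<forall>k\<in>{1..n}. a k \<noteq> 0"
      using z_nz a_nz by auto
    note sq_za = sq[OF this(1)] sq[OF this(2)]
    show ?thesis
      unfolding R1_eq R3_eq T_eq E_eq sq_za by (simp add: mult_ac)
  qed
  ultimately have rhs: "R1 * R2 * R3 * R4 * R5 = (1 / C) * mvalue n Q a z"
    unfolding mvalue_eq by (simp add: mult_ac) (metis mult.assoc mult.left_commute times_divide_eq_left)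

  have "((\<lambda>y. (1 / C) * mterm n Q a z y) has_sum (1 / C) * mvalue n Q a z) (int_tuples n)"
    by (intro has_sum_cmult_right has_sum_mterm[OF z_nz a_nz th conv' Q_def])
  then show ?thesis
    unfolding lhs rhs[symmetric] R1_def R2_def R3_def R4_def R5_def .
qed

end
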